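(* Let $\mathbb C$ be a finitely cocomplete homological category, $A,G$ objects of $\mathbb C$, and $\psi:(A|G)\to A$ a map. Then $\psi$ can be extended (along $j_{A,G}$) to a $\mathbb T$-algebra $\xi:TA\to A$ if and only if the following three equations hold (each being the commutativity of a diagram): (1) $\psi\circ c^{(A|G),A+G}\!\upharpoonright_A\;=\;c_2^A\circ(\psi|1_A)\;:\;((A|G)|A)\to A$; (2) $\psi\circ c^{(A|G),A+G}\!\upharpoonright_G\;=\;\psi\circ(\psi|1_G)\;:\;((A|G)|G)\to A$; (3) $\psi\circ c'\circ(\langle j_{A,G},\eta_A\rangle|1_G)\circ\iota\;=\;\psi\circ(\langle\psi,1_A\rangle|1_G)\circ\iota\;:\;((A|G)|A|G)\to A$, where $\iota:((A|G)|A|G)\to((A|G)+A\,|\,G)$ is the inclusion.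
   Context: Homological means pointed, finitely complete, regular and protomodular. $\langle f,g\rangle$ denotes the map out of a sum with components $f,g$. For objects $A,G$: $i_A,i_G$ are the injections into $A+G$; $r_A=\langle1,0\rangle$, $r_G=\langle0,1\rangle$ are the retractions of $A+G$ onto $A$, $G$. $(A|G)$ is the kernel of the canonical map $A+G\to A\times G$, with inclusion $\iota_{A,G}:(A|G)\to A+G$; for $a:A\to A'$, $g:G\to G'$, $(a|g):(A|G)\to(A'|G')$ is the map with $\iota(a|g)=(a+g)\iota$. The triple cross-effect $(X|Y|Z)$ is the kernel of the map $((r_X|1),(r_Y|1))^t:(X+Y|Z)\to(X|Z)\times(Y|Z)$, with inclusion $\iota:(X|Y|Z)\to(X+Y|Z)$. With $G$ fixed, $TA=T_G(A)=\mathrm{Ker}(r_G)$ with inclusion $k_{A,G}:TA\to A+G$; $j_{A,G}:(A|G)\to TA$ is the unique map with $k_{A,G}j_{A,G}=\iota_{A,G}$. $T$ underlies a monad $\mathbb T=\mathbb T_G$ with unit $\eta_A$ ($k_{A,G}\eta_A=i_A$) and multiplication $\mu_A:T(TA)\to TA$ ($k_{A,G}\mu_A=\langle k_{A,G},i_G\rangle k_{TA,G}$); $T$ acts on a map $a$ by restriction of $a+1_G$. A $\mathbb T$-algebra is a map $\xi:TA\to A$ with $\xi\eta_A=1_A$ and $\xi\mu_A=\xi\,T\xi$; it extends $\psi$ if $\xi j_{A,G}=\psi$. For an object $E$, $c_2^E=\nabla_E\,\iota_{E,E}:(E|E)\to E$ with $\nabla_E=\langle1,1\rangle$. For a proper subobject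 $n:N\to E$ (i.e. a kernel of some map), the conjugation action $c^{N,E}:(N|E)\to N$ is the unique map with $n\,c^{N,E}=c_2^E(n|1)$. $c^{(A|G),A+G}\!\upharpoonright_A=c^{(A|G),A+G}(1|i_A)$ and $c^{(A|G),A+G}\!\upharpoonright_G=c^{(A|G),A+G}(1|i_G)$, where $(A|G)$ is a proper subobject of $A+G$ via $\iota_{A,G}$. Similarly $c=c^{TA,A+G}(1|i_G):(TA|G)\to TA$, where $TA$ is proper in $A+G$ via $k_{A,G}$; the map $c$ factors through $j_{A,G}$, and $c':(TA|G)\to(A|G)$ denotes the unique map with $j_{A,G}c'=c$. *)

theory Defs
  imports Main
begin

section \<open>Categories\<close>

record ('o, 'm) cat =
  Obj :: "'o set"
  Arr :: "'m set"
  Dom :: "'m \<Rightarrow> 'o"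
  Cod :: "'m \<Rightarrow> 'o"
  Ide :: "'o \<Rightarrow> 'm"
  Cmp :: "'m \<Rightarrow> 'm \<Rightarrow> 'm"  (infixr "\<cdot>\<index>" 70)

definition hom :: "('o, 'm) cat \<Rightarrow> 'o \<Rightarrow> 'o \<Rightarrow> 'm set" where
  "hom C A B = {f \<in> Arr C. Dom C f = A \<and> Cod C f = B}"

definition category :: "('o, 'm) cat \<Rightarrow> bool" where
  "category C \<longleftrightarrow>
     (\<forall>f \<in> Arr C. Dom C f \<in> Obj C \<and> Cod C f \<in> Obj C) \<and>
     (\<forall>A \<in> Obj C. Ide C A \<in> hom C A A) \<and>
     (\<forall>f \<in> Arr C. \<forall>g \<in> Arr C. Dom C g = Cod C f \<longrightarrow>
        g \<cdot>\<^bsub>C\<^esub> f \<in> hom C (Dom C f) (Cod C g)) \<and>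
     (\<forall>f \<in> Arr C. f \<cdot>\<^bsub>C\<^esub> Ide C (Dom C f) = f \<and> Ide C (Cod C f) \<cdot>\<^bsub>C\<^esub> f = f) \<and>
     (\<forall>f \<in> Arr C. \<forall>g \<in> Arr C. \<forall>h \<in> Arr C. Dom C g = Cod C f \<and> Dom C h = Cod C g \<longrightarrow>
        (h \<cdot>\<^bsub>C\<^esub> g) \<cdot>\<^bsub>C\<^esub> f = h \<cdot>\<^bsub>C\<^esub> (g \<cdot>\<^bsub>C\<^esub> f))"

definition op_cat :: "('o, 'm) cat \<Rightarrow> ('o, 'm) cat" where
  "op_cat C = \<lparr>Obj = Obj C, Arr = Arr C, Dom = Cod C, Cod = Dom C,
               Ide = Ide C, Cmp = (\<lambda>g f. f \<cdot>\<^bsub>C\<^esub> g)\<rparr>"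

definition is_functor ::
  "('i, 'j) cat \<Rightarrow> ('o, 'm) cat \<Rightarrow> ('i \<Rightarrow> 'o) \<Rightarrow> ('j \<Rightarrow> 'm) \<Rightarrow> bool" where
  "is_functor J C Fo Fa \<longleftrightarrow>
     category J \<and> category C \<and>
     (\<forall>i \<in> Obj J. Fo i \<in> Obj C) \<and>
     (\<forall>u \<in> Arr J. Fa u \<in> hom C (Fo (Dom J u)) (Fo (Cod J u))) \<and>
     (\<forall>i \<in> Obj J. Fa (Ide J i) = Ide C (Fo i)) \<and>
     (\<forall>u \<in> Arr J. \<forall>v \<in> Arr J. Dom J v = Cod J u \<longrightarrow>
        Fa (v \<cdot>\<^bsub>J\<^esub> u) = Fa v \<cdot>\<^bsub>C\<^esub> Fa u)"

definition is_cone ::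
  "('i, 'j) cat \<Rightarrow> ('o, 'm) cat \<Rightarrow> ('i \<Rightarrow> 'o) \<Rightarrow> ('j \<Rightarrow> 'm) \<Rightarrow> 'o \<Rightarrow> ('i \<Rightarrow> 'm) \<Rightarrow> bool" where
  "is_cone J C Fo Fa L p \<longleftrightarrow>
     L \<in> Obj C \<and>
     (\<forall>i \<in> Obj J. p i \<in> hom C L (Fo i)) \<and>
     (\<forall>u \<in> Arr J. Fa u \<cdot>\<^bsub>C\<^esub> p (Dom J u) = p (Cod J u))"

definition is_limit ::
  "('i, 'j) cat \<Rightarrow> ('o, 'm) cat \<Rightarrow> ('i \<Rightarrow> 'o) \<Rightarrow> ('j \<Rightarrow> 'm) \<Rightarrow> 'o \<Rightarrow> ('i \<Rightarrow> 'm) \<Rightarrow> bool" where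
  "is_limit J C Fo Fa L p \<longleftrightarrow>
     is_cone J C Fo Fa L p \<and>
     (\<forall>M q. is_cone J C Fo Fa M q \<longrightarrow>
        (\<exists>!h. h \<in> hom C M L \<and> (\<forall>i \<in> Obj J. p i \<cdot>\<^bsub>C\<^esub> h = q i)))"

text \<open>Every finite category is isomorphic to one whose objects and arrows are natural
  numbers, so the restriction on the type of \<open>J\<close> is harmless.\<close>

definition finitely_complete :: "('o, 'm) cat \<Rightarrow> bool" where
  "finitely_complete C \<longleftrightarrow>
     category C \<and>
     (\<forall>(J :: (nat, nat) cat) Fo Fa.
        finite (Obj J) \<and> finite (Arr J) \<and> is_functor J C Fo Fa \<longrightarrow>
        (\<exists>L p. is_limit J C Fo Fa L p))"

definition finitely_cocomplete :: "('o, 'm) cat \<Rightarrow> bool" where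
  "finitely_cocomplete C \<longleftrightarrow> category C \<and> finitely_complete (op_cat C)"


section \<open>Homological categories\<close>

definition is_iso :: "('o, 'm) cat \<Rightarrow> 'm \<Rightarrow> bool" where
  "is_iso C f \<longleftrightarrow> f \<in> Arr C \<and>
     (\<exists>g \<in> hom C (Cod C f) (Dom C f).
        g \<cdot>\<^bsub>C\<^esub> f = Ide C (Dom C f) \<and> f \<cdot>\<^bsub>C\<^esub> g = Ide C (Cod C f))"

definition is_zero_object :: "('o, 'm) cat \<Rightarrow> 'o \<Rightarrow> bool" where
  "is_zero_object C Z \<longleftrightarrow> Z \<in> Obj C \<and>
     (\<forall>A \<in> Obj C. (\<exists>!f. f \<in> hom C A Z) \<and> (\<exists>!f. f \<in> hom C Z A))"

definition pointed :: "('o, 'm) cat \<Rightarrow> bool" where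
  "pointed C \<longleftrightarrow> category C \<and> (\<exists>Z. is_zero_object C Z)"

definition zero_arr :: "('o, 'm) cat \<Rightarrow> 'o \<Rightarrow> 'o \<Rightarrow> 'm" where
  "zero_arr C A B =
     (THE f. \<exists>Z g h. is_zero_object C Z \<and> g \<in> hom C A Z \<and> h \<in> hom C Z B \<and> f = h \<cdot>\<^bsub>C\<^esub> g)"

definition is_pullback :: "('o, 'm) cat \<Rightarrow> 'm \<Rightarrow> 'm \<Rightarrow> 'm \<Rightarrow> 'm \<Rightarrow> bool" where
  "is_pullback C f g p q \<longleftrightarrow>
     f \<in> Arr C \<and> g \<in> Arr C \<and> Cod C f = Cod C g \<and>
     p \<in> hom C (Dom C p) (Dom C f) \<and> q \<in> hom C (Dom C p) (Dom C g) \<and>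
     f \<cdot>\<^bsub>C\<^esub> p = g \<cdot>\<^bsub>C\<^esub> q \<and>
     (\<forall>X. \<forall>x \<in> hom C X (Dom C f). \<forall>y \<in> hom C X (Dom C g). f \<cdot>\<^bsub>C\<^esub> x = g \<cdot>\<^bsub>C\<^esub> y \<longrightarrow>
        (\<exists>!h. h \<in> hom C X (Dom C p) \<and> p \<cdot>\<^bsub>C\<^esub> h = x \<and> q \<cdot>\<^bsub>C\<^esub> h = y))"

definition is_coequalizer :: "('o, 'm) cat \<Rightarrow> 'm \<Rightarrow> 'm \<Rightarrow> 'm \<Rightarrow> bool" where
  "is_coequalizer C f g e \<longleftrightarrow>
     f \<in> Arr C \<and> g \<in> hom C (Dom C f) (Cod C f) \<and>
     e \<in> hom C (Cod C f) (Cod C e) \<and> e \<cdot>\<^bsub>C\<^esub> f = e \<cdot>\<^bsub>C\<^esub> g \<and>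
     (\<forall>X. \<forall>x \<in> hom C (Cod C f) X. x \<cdot>\<^bsub>C\<^esub> f = x \<cdot>\<^bsub>C\<^esub> g \<longrightarrow>
        (\<exists>!u. u \<in> hom C (Cod C e) X \<and> u \<cdot>\<^bsub>C\<^esub> e = x))"

definition regular_epi :: "('o, 'm) cat \<Rightarrow> 'm \<Rightarrow> bool" where
  "regular_epi C e \<longleftrightarrow> (\<exists>f g. is_coequalizer C f g e)"

definition regular_category :: "('o, 'm) cat \<Rightarrow> bool" where
  "regular_category C \<longleftrightarrow>
     finitely_complete C \<and>
     (\<forall>f p q. is_pullback C f f p q \<longrightarrow> (\<exists>e. is_coequalizer C p q e)) \<and>
     (\<forall>f g p q. is_pullback C f g p q \<and> regular_epi C f \<longrightarrow> regular_epi C q)"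

text \<open>Points over \<open>B\<close>: split epimorphisms with codomain \<open>B\<close> and a chosen section.\<close>

definition is_point :: "('o, 'm) cat \<Rightarrow> 'o \<Rightarrow> 'm \<Rightarrow> 'm \<Rightarrow> bool" where
  "is_point C B p s \<longleftrightarrow>
     p \<in> hom C (Dom C p) B \<and> s \<in> hom C B (Dom C p) \<and> p \<cdot>\<^bsub>C\<^esub> s = Ide C B"

definition point_map :: "('o, 'm) cat \<Rightarrow> 'm \<Rightarrow> 'm \<Rightarrow> 'm \<Rightarrow> 'm \<Rightarrow> 'm \<Rightarrow> bool" where
  "point_map C p s p' s' h \<longleftrightarrow>
     h \<in> hom C (Dom C p) (Dom C p') \<and> p' \<cdot>\<^bsub>C\<^esub> h = p \<and> h \<cdot>\<^bsub>C\<^esub> s = s'"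

text \<open>Protomodularity in the sense of Bourn: for each \<open>v : X \<rightarrow> B\<close> the change-of-base functor
  from points over \<open>B\<close> to points over \<open>X\<close> reflects isomorphisms.  Below \<open>q\<close> and \<open>q'\<close> are the
  pullbacks of \<open>p\<close> and \<open>p'\<close> along \<open>v\<close>, and \<open>k\<close> is the image of \<open>h\<close> under that functor (the two defining
  equations determine \<open>k\<close> and make it compatible with the induced sections).\<close>

definition protomodular :: "('o, 'm) cat \<Rightarrow> bool" where
  "protomodular C \<longleftrightarrow>
     finitely_complete C \<and>
     (\<forall>v \<in> Arr C. \<forall>p s p' s' h w q w' q' k.
        is_point C (Cod C v) p s \<and> is_point C (Cod C v) p' s' \<and> point_map C p s p' s' h \<and>
        is_pullback C p v w q \<and> is_pullback C p' v w' q' \<and>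
        k \<in> hom C (Dom C q) (Dom C q') \<and> w' \<cdot>\<^bsub>C\<^esub> k = h \<cdot>\<^bsub>C\<^esub> w \<and> q' \<cdot>\<^bsub>C\<^esub> k = q \<and>
        is_iso C k \<longrightarrow> is_iso C h)"

definition homological :: "('o, 'm) cat \<Rightarrow> bool" where
  "homological C \<longleftrightarrow>
     pointed C \<and> finitely_complete C \<and> regular_category C \<and> protomodular C"


section \<open>Chosen products, sums and kernels\<close>

text \<open>\<open>lift C m f\<close> is the factorization of \<open>f\<close> through the monomorphism \<open>m\<close>.\<close>

definition lift :: "('o, 'm) cat \<Rightarrow> 'm \<Rightarrow> 'm \<Rightarrow> 'm" where
  "lift C m f = (THE h. h \<in> hom C (Dom C f) (Dom C m) \<and> m \<cdot>\<^bsub>C\<^esub> h = f)"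

definition is_product :: "('o, 'm) cat \<Rightarrow> 'o \<Rightarrow> 'o \<Rightarrow> 'm \<times> 'm \<Rightarrow> bool" where
  "is_product C A B = (\<lambda>(p, q).
     p \<in> hom C (Dom C p) A \<and> q \<in> hom C (Dom C p) B \<and>
     (\<forall>X. \<forall>f \<in> hom C X A. \<forall>g \<in> hom C X B.
        \<exists>!h. h \<in> hom C X (Dom C p) \<and> p \<cdot>\<^bsub>C\<^esub> h = f \<and> q \<cdot>\<^bsub>C\<^esub> h = g))"

definition prod_projs :: "('o, 'm) cat \<Rightarrow> 'o \<Rightarrow> 'o \<Rightarrow> 'm \<times> 'm" where
  "prod_projs C A B = (SOME pq. is_product C A B pq)"

definition prj1 :: "('o, 'm) cat \<Rightarrow> 'o \<Rightarrow> 'o \<Rightarrow> 'm" where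
  "prj1 C A B = fst (prod_projs C A B)"

definition prj2 :: "('o, 'm) cat \<Rightarrow> 'o \<Rightarrow> 'o \<Rightarrow> 'm" where
  "prj2 C A B = snd (prod_projs C A B)"

definition prod_obj :: "('o, 'm) cat \<Rightarrow> 'o \<Rightarrow> 'o \<Rightarrow> 'o" where
  "prod_obj C A B = Dom C (prj1 C A B)"

definition pair :: "('o, 'm) cat \<Rightarrow> 'm \<Rightarrow> 'm \<Rightarrow> 'm" where
  "pair C f g =
     (THE h. h \<in> hom C (Dom C f) (prod_obj C (Cod C f) (Cod C g)) \<and>
        prj1 C (Cod C f) (Cod C g) \<cdot>\<^bsub>C\<^esub> h = f \<and> prj2 C (Cod C f) (Cod C g) \<cdot>\<^bsub>C\<^esub> h = g)"

definition is_coproduct :: "('o, 'm) cat \<Rightarrow> 'o \<Rightarrow> 'o \<Rightarrow> 'm \<times> 'm \<Rightarrow> bool" where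
  "is_coproduct C A B = (\<lambda>(i, j).
     i \<in> hom C A (Cod C i) \<and> j \<in> hom C B (Cod C i) \<and>
     (\<forall>X. \<forall>f \<in> hom C A X. \<forall>g \<in> hom C B X.
        \<exists>!h. h \<in> hom C (Cod C i) X \<and> h \<cdot>\<^bsub>C\<^esub> i = f \<and> h \<cdot>\<^bsub>C\<^esub> j = g))"

definition sum_injs :: "('o, 'm) cat \<Rightarrow> 'o \<Rightarrow> 'o \<Rightarrow> 'm \<times> 'm" where
  "sum_injs C A B = (SOME ij. is_coproduct C A B ij)"

definition inj1 :: "('o, 'm) cat \<Rightarrow> 'o \<Rightarrow> 'o \<Rightarrow> 'm" where
  "inj1 C A B = fst (sum_injs C A B)"

definition inj2 :: "('o, 'm) cat \<Rightarrow> 'o \<Rightarrow> 'o \<Rightarrow> 'm" where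
  "inj2 C A B = snd (sum_injs C A B)"

definition sum_obj :: "('o, 'm) cat \<Rightarrow> 'o \<Rightarrow> 'o \<Rightarrow> 'o" where
  "sum_obj C A B = Cod C (inj1 C A B)"

definition copair :: "('o, 'm) cat \<Rightarrow> 'm \<Rightarrow> 'm \<Rightarrow> 'm" where
  "copair C f g =
     (THE h. h \<in> hom C (sum_obj C (Dom C f) (Dom C g)) (Cod C f) \<and>
        h \<cdot>\<^bsub>C\<^esub> inj1 C (Dom C f) (Dom C g) = f \<and> h \<cdot>\<^bsub>C\<^esub> inj2 C (Dom C f) (Dom C g) = g)"

definition sum_map :: "('o, 'm) cat \<Rightarrow> 'm \<Rightarrow> 'm \<Rightarrow> 'm" where
  "sum_map C a g =
     copair C (inj1 C (Cod C a) (Cod C g) \<cdot>\<^bsub>C\<^esub> a) (inj2 C (Cod C a) (Cod C g) \<cdot>\<^bsub>C\<^esub> g)"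

definition retr1 :: "('o, 'm) cat \<Rightarrow> 'o \<Rightarrow> 'o \<Rightarrow> 'm" where
  "retr1 C A G = copair C (Ide C A) (zero_arr C G A)"

definition retr2 :: "('o, 'm) cat \<Rightarrow> 'o \<Rightarrow> 'o \<Rightarrow> 'm" where
  "retr2 C A G = copair C (zero_arr C A G) (Ide C G)"

definition is_kernel :: "('o, 'm) cat \<Rightarrow> 'm \<Rightarrow> 'm \<Rightarrow> bool" where
  "is_kernel C f k \<longleftrightarrow>
     f \<in> Arr C \<and> k \<in> hom C (Dom C k) (Dom C f) \<and>
     f \<cdot>\<^bsub>C\<^esub> k = zero_arr C (Dom C k) (Cod C f) \<and>
     (\<forall>X. \<forall>x \<in> hom C X (Dom C f). f \<cdot>\<^bsub>C\<^esub> x = zero_arr C X (Cod C f) \<longrightarrow>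
        (\<exists>!h. h \<in> hom C X (Dom C k) \<and> k \<cdot>\<^bsub>C\<^esub> h = x))"

definition ker :: "('o, 'm) cat \<Rightarrow> 'm \<Rightarrow> 'm" where
  "ker C f = (SOME k. is_kernel C f k)"


section \<open>Cross-effects\<close>

text \<open>\<open>cr2 C A G\<close> is \<open>(A|G)\<close>, \<open>cr2_incl C A G\<close> its inclusion into \<open>A + G\<close>, and
  \<open>cr2_map C a g\<close> is \<open>(a|g)\<close>; \<open>cr3_incl C X Y Z\<close> is the inclusion of
  \<open>(X|Y|Z)\<close> into \<open>(X + Y|Z)\<close>.\<close>

definition cr2_incl :: "('o, 'm) cat \<Rightarrow> 'o \<Rightarrow> 'o \<Rightarrow> 'm" where
  "cr2_incl C A G = ker C (pair C (retr1 C A G) (retr2 C A G))"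

definition cr2 :: "('o, 'm) cat \<Rightarrow> 'o \<Rightarrow> 'o \<Rightarrow> 'o" where
  "cr2 C A G = Dom C (cr2_incl C A G)"

definition cr2_map :: "('o, 'm) cat \<Rightarrow> 'm \<Rightarrow> 'm \<Rightarrow> 'm" where
  "cr2_map C a g =
     lift C (cr2_incl C (Cod C a) (Cod C g)) (sum_map C a g \<cdot>\<^bsub>C\<^esub> cr2_incl C (Dom C a) (Dom C g))"

definition cr3_incl :: "('o, 'm) cat \<Rightarrow> 'o \<Rightarrow> 'o \<Rightarrow> 'o \<Rightarrow> 'm" where
  "cr3_incl C X Y Z =
     ker C (pair C (cr2_map C (retr1 C X Y) (Ide C Z)) (cr2_map C (retr2 C X Y) (Ide C Z)))"


section \<open>The monad \<open>T\<^sub>G\<close> and its algebras\<close>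

definition T_incl :: "('o, 'm) cat \<Rightarrow> 'o \<Rightarrow> 'o \<Rightarrow> 'm" where
  "T_incl C G A = ker C (retr2 C A G)"

definition T_obj :: "('o, 'm) cat \<Rightarrow> 'o \<Rightarrow> 'o \<Rightarrow> 'o" where
  "T_obj C G A = Dom C (T_incl C G A)"

definition T_map :: "('o, 'm) cat \<Rightarrow> 'o \<Rightarrow> 'm \<Rightarrow> 'm" where
  "T_map C G a = lift C (T_incl C G (Cod C a)) (sum_map C a (Ide C G) \<cdot>\<^bsub>C\<^esub> T_incl C G (Dom C a))"

definition T_unit :: "('o, 'm) cat \<Rightarrow> 'o \<Rightarrow> 'o \<Rightarrow> 'm" where
  "T_unit C G A = lift C (T_incl C G A) (inj1 C A G)"

definition T_mult :: "('o, 'm) cat \<Rightarrow> 'o \<Rightarrow> 'o \<Rightarrow> 'm" where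
  "T_mult C G A =
     lift C (T_incl C G A) (copair C (T_incl C G A) (inj2 C A G) \<cdot>\<^bsub>C\<^esub> T_incl C G (T_obj C G A))"

definition T_algebra :: "('o, 'm) cat \<Rightarrow> 'o \<Rightarrow> 'o \<Rightarrow> 'm \<Rightarrow> bool" where
  "T_algebra C G A \<xi> \<longleftrightarrow>
     \<xi> \<in> hom C (T_obj C G A) A \<and>
     \<xi> \<cdot>\<^bsub>C\<^esub> T_unit C G A = Ide C A \<and>
     \<xi> \<cdot>\<^bsub>C\<^esub> T_mult C G A = \<xi> \<cdot>\<^bsub>C\<^esub> T_map C G \<xi>"

definition j_incl :: "('o, 'm) cat \<Rightarrow> 'o \<Rightarrow> 'o \<Rightarrow> 'm" where
  "j_incl C A G = lift C (T_incl C G A) (cr2_incl C A G)"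


section \<open>Conjugation actions\<close>

definition c2 :: "('o, 'm) cat \<Rightarrow> 'o \<Rightarrow> 'm" where
  "c2 C E = copair C (Ide C E) (Ide C E) \<cdot>\<^bsub>C\<^esub> cr2_incl C E E"

text \<open>\<open>conj_act C n\<close> is meant only for normal monomorphisms \<open>n\<close> (kernels).\<close>

definition conj_act :: "('o, 'm) cat \<Rightarrow> 'm \<Rightarrow> 'm" where
  "conj_act C n = lift C n (c2 C (Cod C n) \<cdot>\<^bsub>C\<^esub> cr2_map C n (Ide C (Cod C n)))"

definition conj_cr2_1 :: "('o, 'm) cat \<Rightarrow> 'o \<Rightarrow> 'o \<Rightarrow> 'm" where
  "conj_cr2_1 C A G =
     conj_act C (cr2_incl C A G) \<cdot>\<^bsub>C\<^esub> cr2_map C (Ide C (cr2 C A G)) (inj1 C A G)"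

definition conj_cr2_2 :: "('o, 'm) cat \<Rightarrow> 'o \<Rightarrow> 'o \<Rightarrow> 'm" where
  "conj_cr2_2 C A G =
     conj_act C (cr2_incl C A G) \<cdot>\<^bsub>C\<^esub> cr2_map C (Ide C (cr2 C A G)) (inj2 C A G)"

definition conj_T :: "('o, 'm) cat \<Rightarrow> 'o \<Rightarrow> 'o \<Rightarrow> 'm" where
  "conj_T C A G =
     conj_act C (T_incl C G A) \<cdot>\<^bsub>C\<^esub> cr2_map C (Ide C (T_obj C G A)) (inj2 C A G)"

definition conj_T' :: "('o, 'm) cat \<Rightarrow> 'o \<Rightarrow> 'o \<Rightarrow> 'm" where
  "conj_T' C A G = lift C (j_incl C A G) (conj_T C A G)"

end

theory Submission
  imports Defs
begin

text \<open>By protomodularity the kernel \<open>j : (A|G) \<rightarrow> TA\<close> and the section \<open>\<eta>\<close> of the split epimorphism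
  \<open>TA \<rightarrow> A\<close> make \<open>e = \<langle>j,\<eta>\<rangle> : (A|G) + A \<rightarrow> TA\<close> a regular epimorphism, hence the cokernel of its
  kernel.  So \<open>\<langle>\<psi>,1\<rangle>\<close> factors through \<open>e\<close> as soon as it kills \<open>Ker e\<close>, and equation (1) says just
  that; the factorization is the unique \<open>\<xi>\<close> with \<open>\<xi> j = \<psi>\<close>
    and \<open>\<xi> \<eta> = 1\<close>.  Restricted along
  \<open>j\<close>, associativity of \<open>\<xi>\<close> reads \<open>\<psi> c' = \<psi> (\<xi>|1)\<close>.  As \<open>Te\<close> is again a regular epimorphism, this may
  be tested after precomposition with \<open>(e|1)\<close>, on the three jointly epic pieces \<open>((A|G)|G)\<close>,
  \<open>(A|G)\<close> and \<open>((A|G)|A|G)\<close> of \<open>((A|G) + A|G)\<close>: these give equation (2), nothing, and equation (3).\<close>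

text \<open>The bridge is the monad for A in place of G: e followed by TA -> A is the retraction of
  (A|G) + A onto A, so Ker e lies in T_A(A|G). That object is jointly covered by ((A|G)|A) and its
  unit, and on the unit the required equation is trivial. The detour through e in the second half is
  forced by equation (3): the triple cross-effect decomposes ((A|G) + A|G), a cross-effect of a sum,
  and offers no such decomposition of (TA|G). To come back from the sum one needs an epimorphism,
  and Te is one because it is a pullback of e + 1. What T((A|G) + A) contains besides the
  cross-effect is covered by the unit, where both composites reduce to \<xi> e. That regular
  epimorphisms are cokernels is not among the axioms of a homological category; it again comes from
  protomodularity, applied to a projection of the kernel pair split by the diagonal.\<close>

lemma in_hom_iff [simp]: "f \<in> hom C A B \<longleftrightarrow> f \<in> Arr C \<and> Dom C f = A \<and> Cod C f = B"
  by (simp add: hom_def)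

section \<open>Arrow calculus, and pullbacks from finite limits\<close>

locale category_locale =
  fixes C :: "('o, 'm) cat" (structure)
  assumes category: "category C"
begin

lemma
  shows Dom_Obj [simp]: "f \<in> Arr C \<Longrightarrow> Dom C f \<in> Obj C"
    and Cod_Obj [simp]: "f \<in> Arr C \<Longrightarrow> Cod C f \<in> Obj C"
    and Ide_Arr [simp]: "A \<in> Obj C \<Longrightarrow> Ide C A \<in> Arr C"
    and Dom_Ide [simp]: "A \<in> Obj C \<Longrightarrow> Dom C (Ide C A) = A"
    and Cod_Ide [simp]: "A \<in> Obj C \<Longrightarrow> Cod C (Ide C A) = A"
    and comp_Arr [simp]: "\<lbrakk>f \<in> Arr C; g \<in> Arr C; Dom C g = Cod C f\<rbrakk> \<Longrightarrow> g \<cdot> f \<in> Arr C"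
    and Dom_comp [simp]: "\<lbrakk>f \<in> Arr C; g \<in> Arr C; Dom C g = Cod C f\<rbrakk> \<Longrightarrow> Dom C (g \<cdot> f) = Dom C f"
    and Cod_comp [simp]: "\<lbrakk>f \<in> Arr C; g \<in> Arr C; Dom C g = Cod C f\<rbrakk> \<Longrightarrow> Cod C (g \<cdot> f) = Cod C g"
    and comp_Ide [simp]: "\<lbrakk>f \<in> Arr C; Dom C f = A\<rbrakk> \<Longrightarrow> f \<cdot> Ide C A = f"
    and Ide_comp [simp]: "\<lbrakk>f \<in> Arr C; Cod C f = A\<rbrakk> \<Longrightarrow> Ide C A \<cdot> f = f"
    and assoc [simp]: "\<lbrakk>f \<in> Arr C; g \<in> Arr C; h \<in> Arr C; Dom C g = Cod C f; Dom C h = Cod C g\<rbrakk>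
      \<Longrightarrow> (h \<cdot> g) \<cdot> f = h \<cdot> (g \<cdot> f)"
  using category by (auto simp: category_def)

text \<open>Because \<open>assoc\<close> as a simp rule nests composites to the right, an equation
  for \<open>g \<cdot> f\<close> no longer matches inside \<open>g \<cdot> (f \<cdot> x)\<close>;
  this form applies it there.\<close>

lemma comp_reduce:
  assumes "g \<cdot> f = h" "f \<in> Arr C"
    "g \<in> Arr C" "Dom C g = Cod C f" "x \<in> Arr C" "Cod C x = Dom C f"
  shows "g \<cdot> (f \<cdot> x) = h \<cdot> x"
  using assms by (metis assoc)

text \<open>Stated for any finitely complete category, so that it can also be read in the opposite
  category, where it yields pushouts.\<close>

lemma pullback_exists:
  assumes fc: "finitely_complete C"
    and f: "f \<in> Arr C" and g: "g \<in> Arr C" and fg: "Cod C f = Cod C g"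
  shows "\<exists>p q. is_pullback C f g p q"
proof -
  \<comment> \<open>The cospan shape: 0, 1, 2 are the objects and at the same time their identities,
    3 : 0 -> 2 and 4 : 1 -> 2 are the legs. In every composable pair one factor is an identity,
    which is why \<open>Cmp\<close> can decide by \<open>v \<le> 2\<close> alone.\<close>
  define J :: "(nat, nat) cat" where "J = \<lparr>Obj = {0, 1, 2}, Arr = {0, 1, 2, 3, 4},
    Dom = (\<lambda>u. if u = 3 then 0 else if u = 4 then 1 else u),
    Cod = (\<lambda>u. if u = 3 \<or> u = 4 then 2 else u), Ide = id,
    Cmp = (\<lambda>v u. if v \<le> 2 then u else v)\<rparr>"
  define Fo where "Fo = (\<lambda>i::nat. if i = 0 then Dom C f else if i = 1 then Dom C g else Cod C f)"
  define Fa where "Fa = (\<lambda>u::nat. if u = 3 then f else if u = 4 then g else Ide C (Fo u))"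
  have J: "category J" by (simp add: category_def J_def)
  have "is_functor J C Fo Fa"
    using J category f g fg Cod_Obj[OF g] unfolding is_functor_def
    by (simp add: J_def Fo_def Fa_def)
  moreover have "finite (Obj J)" "finite (Arr J)" by (simp_all add: J_def)
  ultimately obtain L p where L: "is_limit J C Fo Fa L p"
    using fc unfolding finitely_complete_def by blast
  have p: "p 0 \<in> hom C L (Dom C f)" "p 1 \<in> hom C L (Dom C g)"
      "f \<cdot> p 0 = p 2" "g \<cdot> p 1 = p 2"
    using L by (simp_all add: is_limit_def is_cone_def J_def Fo_def Fa_def)
  have univ: "\<exists>!h. h \<in> hom C X L \<and> p 0 \<cdot> h = x \<and> p 1 \<cdot> h = y"
    if x: "x \<in> hom C X (Dom C f)" and y: "y \<in> hom C X (Dom C g)"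
      and e: "f \<cdot> x = g \<cdot> y" for X x y
  proof -
    have "is_cone J C Fo Fa X (\<lambda>i. if i = 0 then x else if i = 1 then y else f \<cdot> x)"
      using x y e[symmetric] f g fg Dom_Obj[of x] by (auto simp: is_cone_def J_def Fo_def Fa_def)
    then have *: "\<exists>!h. h \<in> hom C X L \<and> (\<forall>i \<in> Obj J. p i \<cdot> h =
        (if i = 0 then x else if i = 1 then y else f \<cdot> x))"
      using L unfolding is_limit_def by blast
    \<comment> \<open>A limit cone also has a component at the vertex 2. It is forced by the
      component at 0, so limits of the cospan and pullbacks have the same mediating arrows.\<close>
    have "p 2 \<cdot> h = f \<cdot> x" if "h \<in> hom C X L" "p 0 \<cdot> h = x" for h
    proof -
      have "p 2 \<cdot> h = (f \<cdot> p 0) \<cdot> h" using p by simp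
      also have "\<dots> = f \<cdot> (p 0 \<cdot> h)" using p(1) f that(1) by (intro assoc) auto
      finally show ?thesis using that by simp
    qed
    then have "(h \<in> hom C X L \<and> (\<forall>i \<in> Obj J. p i \<cdot> h =
        (if i = 0 then x else if i = 1 then y else f \<cdot> x))) \<longleftrightarrow>
        (h \<in> hom C X L \<and> p 0 \<cdot> h = x \<and> p 1 \<cdot> h = y)" for h
      by (auto simp: J_def)
    then show ?thesis using * by simp
  qed
  have "Dom C (p 0) = L" using p by simp
  then have "is_pullback C f g (p 0) (p 1)"
    unfolding is_pullback_def by (intro conjI allI ballI impI) (use f g fg p univ in simp_all)
  then show ?thesis by blast
qed

end

locale homological_category = category_locale C for C :: "('o, 'm) cat" (structure) +
  assumes homological: "homological C" and cocomplete: "finitely_cocomplete C"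
begin

section \<open>Zero arrows, products and sums\<close>

lemma zero_object_unique:
  assumes "is_zero_object C Z"
  shows "\<lbrakk>f \<in> Arr C; g \<in> Arr C; Dom C f = Dom C g; Cod C f = Z; Cod C g = Z\<rbrakk> \<Longrightarrow> f = g"
    and "\<lbrakk>f \<in> Arr C; g \<in> Arr C; Dom C f = Z; Dom C g = Z; Cod C f = Cod C g\<rbrakk> \<Longrightarrow> f = g"
proof -
  assume *: "f \<in> Arr C" "g \<in> Arr C" "Dom C f = Dom C g" "Cod C f = Z" "Cod C g = Z"
  then have "\<exists>!h. h \<in> hom C (Dom C f) Z" using assms unfolding is_zero_object_def by simp
  then show "f = g" using * by (elim ex1E) auto
next
  assume *: "f \<in> Arr C" "g \<in> Arr C" "Dom C f = Z" "Dom C g = Z" "Cod C f = Cod C g"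
  then have "\<exists>!h. h \<in> hom C Z (Cod C f)" using assms unfolding is_zero_object_def by simp
  then show "f = g" using * by (elim ex1E) auto
qed

lemma zero_object_arrows:
  assumes "is_zero_object C Z" "A \<in> Obj C"
  obtains g h where "g \<in> hom C A Z" "h \<in> hom C Z A"
  using assms unfolding is_zero_object_def by blast

lemma zero_object_exists: obtains Z where "is_zero_object C Z"
  using homological by (auto simp: homological_def pointed_def)

text \<open>The description in \<open>zero_arr\<close> ranges over all zero objects, so its value
  must not depend on the one chosen: an arrow \<open>t\<close> between two zero objects carries one
  factorization into the other.\<close>

lemma zero_arrI:
  assumes Z: "is_zero_object C Z" and g: "g \<in> hom C A Z" and h: "h \<in> hom C Z B"
  shows "zero_arr C A B = h \<cdot> g"
  unfolding zero_arr_def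
proof (rule the_equality)
  show "\<exists>Z g' h'. is_zero_object C Z \<and> g' \<in> hom C A Z \<and> h' \<in> hom C Z B \<and> h \<cdot> g = h' \<cdot> g'"
    using assms by blast
  fix f
  assume "\<exists>Z g' h'. is_zero_object C Z \<and> g' \<in> hom C A Z \<and> h' \<in> hom C Z B \<and> f = h' \<cdot> g'"
  then obtain Z' g' h' where Z': "is_zero_object C Z'" "g' \<in> hom C A Z'" "h' \<in> hom C Z' B"
    and f: "f = h' \<cdot> g'" by blast
  have "Z' \<in> Obj C" using Z' by (simp add: is_zero_object_def)
  then obtain t where t: "t \<in> hom C Z' Z" using zero_object_arrows[OF Z] by metis
  have "t \<cdot> g' = g" by (rule zero_object_unique(1)[OF Z]) (use Z' g t in auto)
  moreover have "h \<cdot> t = h'" by (rule zero_object_unique(2)[OF Z'(1)]) (use Z' h t in auto)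
  ultimately show "f = h \<cdot> g"
    using f Z' h t assoc[of g' t h] by simp
qed

lemma zero_arr_factors:
  assumes "A \<in> Obj C" and "B \<in> Obj C"
  obtains Z g h where "is_zero_object C Z"
    "g \<in> hom C A Z" "h \<in> hom C Z B" "zero_arr C A B = h \<cdot> g"
  by (meson zero_object_exists zero_object_arrows zero_arrI assms)

lemma
  assumes "A \<in> Obj C" "B \<in> Obj C"
  shows zero_Arr [simp]: "zero_arr C A B \<in> Arr C"
    and Dom_zero [simp]: "Dom C (zero_arr C A B) = A"
    and Cod_zero [simp]: "Cod C (zero_arr C A B) = B"
proof -
  obtain Z g h where "g \<in> hom C A Z" "h \<in> hom C Z B" "zero_arr C A B = h \<cdot> g"
    using zero_arr_factors[OF assms] by metis
  then show "zero_arr C A B \<in> Arr C" "Dom C (zero_arr C A B) = A" "Cod C (zero_arr C A B) = B"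
    by simp_all
qed

lemma comp_zero [simp]:
  assumes "f \<in> Arr C" "Dom C f = B" "A \<in> Obj C"
  shows "f \<cdot> zero_arr C A B = zero_arr C A (Cod C f)"
proof -
  obtain Z g h where Z: "is_zero_object C Z"
    "g \<in> hom C A Z" "h \<in> hom C Z B" "zero_arr C A B = h \<cdot> g"
    by (rule zero_arr_factors[of A B]) (use assms in auto)
  then have "zero_arr C A (Cod C f) = (f \<cdot> h) \<cdot> g"
    using assms by (intro zero_arrI) auto
  then show ?thesis using Z assms by simp
qed

lemma zero_comp [simp]:
  assumes "f \<in> Arr C" "Cod C f = B" "D \<in> Obj C"
  shows "zero_arr C B D \<cdot> f = zero_arr C (Dom C f) D"
proof -
  obtain Z g h where Z: "is_zero_object C Z"
    "g \<in> hom C B Z" "h \<in> hom C Z D" "zero_arr C B D = h \<cdot> g"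
    by (rule zero_arr_factors[of B D]) (use assms in auto)
  then have "zero_arr C (Dom C f) D = h \<cdot> (g \<cdot> f)"
    using assms by (intro zero_arrI) auto
  then show ?thesis using Z assms by simp
qed

lemma complete: "finitely_complete C"
  using homological by (simp add: homological_def)

text \<open>Over a zero object every square commutes, so a pullback there is a product.\<close>

lemma product_exists:
  assumes A: "A \<in> Obj C" and B: "B \<in> Obj C"
  shows "\<exists>pq. is_product C A B pq"
proof -
  obtain Z where Z: "is_zero_object C Z" by (rule zero_object_exists)
  obtain a b where ab: "a \<in> hom C A Z" "b \<in> hom C B Z"
    using zero_object_arrows[OF Z A] zero_object_arrows[OF Z B] by metis
  obtain p q where pq: "is_pullback C a b p q"
    using pullback_exists[OF complete, of a b] ab by auto
  have "a \<cdot> f = b \<cdot> g" if "f \<in> hom C X A" "g \<in> hom C X B" for X f g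
    by (rule zero_object_unique(1)[OF Z]) (use ab that in auto)
  then have "is_product C A B (p, q)"
    using pq ab unfolding is_product_def is_pullback_def by simp
  then show ?thesis by blast
qed

text \<open>A pushout under a zero object is a sum; the pushout is obtained as a pullback in
  \<open>op_cat C\<close>.\<close>

lemma coproduct_exists:
  assumes A: "A \<in> Obj C" and B: "B \<in> Obj C"
  shows "\<exists>ij. is_coproduct C A B ij"
proof -
  obtain Z where Z: "is_zero_object C Z" by (rule zero_object_exists)
  obtain a b where ab: "a \<in> hom C Z A" "b \<in> hom C Z B"
    using zero_object_arrows[OF Z A] zero_object_arrows[OF Z B] by metis
  have op: "finitely_complete (op_cat C)" using cocomplete by (simp add: finitely_cocomplete_def)
  interpret op: category_locale "op_cat C"
    using op by unfold_locales (simp add: finitely_complete_def)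
  from op.pullback_exists[OF op, of a b] obtain p q where pq: "is_pullback (op_cat C) a b p q"
    using ab by (auto simp: op_cat_def)
  have "f \<cdot> a = g \<cdot> b" if "f \<in> hom C A X" "g \<in> hom C B X" for X f g
    by (rule zero_object_unique(2)[OF Z]) (use ab that in auto)
  then have "is_coproduct C A B (p, q)"
    using pq ab unfolding is_coproduct_def is_pullback_def by (simp add: op_cat_def conj_commute)
  then show ?thesis by blast
qed

lemma pair_unique:
  assumes "f \<in> Arr C" "g \<in> Arr C" "Dom C f = Dom C g"
  shows "\<exists>!h. h \<in> hom C (Dom C f) (prod_obj C (Cod C f) (Cod C g)) \<and>
        prj1 C (Cod C f) (Cod C g) \<cdot> h = f \<and> prj2 C (Cod C f) (Cod C g) \<cdot> h = g"
proof -
  have "is_product C (Cod C f) (Cod C g) (prod_projs C (Cod C f) (Cod C g))"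
    unfolding prod_projs_def by (rule someI_ex, rule product_exists) (use assms in auto)
  then show ?thesis using assms
    unfolding is_product_def prj1_def prj2_def prod_obj_def split_beta by simp
qed

lemma
  assumes "A \<in> Obj C" "B \<in> Obj C"
  shows prj1_hom: "prj1 C A B \<in> hom C (prod_obj C A B) A"
    and prj2_hom: "prj2 C A B \<in> hom C (prod_obj C A B) B"
proof -
  have "is_product C A B (prod_projs C A B)"
    unfolding prod_projs_def by (rule someI_ex, rule product_exists) (use assms in auto)
  then show "prj1 C A B \<in> hom C (prod_obj C A B) A" "prj2 C A B \<in> hom C (prod_obj C A B) B"
    unfolding is_product_def prj1_def prj2_def prod_obj_def split_beta by simp_all
qed

lemma
  assumes "f \<in> Arr C" "g \<in> Arr C" "Dom C f = Dom C g"
  shows pair_Arr [simp]: "pair C f g \<in> Arr C"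
    and Dom_pair [simp]: "Dom C (pair C f g) = Dom C f"
    and Cod_pair [simp]: "Cod C (pair C f g) = prod_obj C (Cod C f) (Cod C g)"
    and prj1_pair: "prj1 C (Cod C f) (Cod C g) \<cdot> pair C f g = f"
    and prj2_pair: "prj2 C (Cod C f) (Cod C g) \<cdot> pair C f g = g"
  using theI'[OF pair_unique[OF assms], folded pair_def] by simp_all

lemma prod_eqI:
  assumes "u \<in> Arr C" "v \<in> Arr C"
    "Dom C u = Dom C v" "Cod C u = prod_obj C A B" "Cod C v = prod_obj C A B"
    and [simp]: "A \<in> Obj C" "B \<in> Obj C"
    and "prj1 C A B \<cdot> u = prj1 C A B \<cdot> v" "prj2 C A B \<cdot> u = prj2 C A B \<cdot> v"
  shows "u = v"
proof -
  let ?f = "prj1 C A B \<cdot> u" and ?g = "prj2 C A B \<cdot> u"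
  have "\<exists>!h. h \<in> hom C (Dom C ?f) (prod_obj C (Cod C ?f) (Cod C ?g)) \<and>
      prj1 C (Cod C ?f) (Cod C ?g) \<cdot> h = ?f \<and> prj2 C (Cod C ?f) (Cod C ?g) \<cdot> h = ?g"
    by (rule pair_unique) (use assms prj1_hom[of A B] prj2_hom[of A B] in simp_all)
  moreover have "Cod C ?f = A" "Cod C ?g = B" "Dom C ?f = Dom C u"
    using assms prj1_hom[of A B] prj2_hom[of A B] by simp_all
  ultimately have "\<exists>!h. h \<in> hom C (Dom C u) (prod_obj C A B) \<and>
      prj1 C A B \<cdot> h = ?f \<and> prj2 C A B \<cdot> h = ?g"
    by (simp only:)
  moreover have "u \<in> hom C (Dom C u) (prod_obj C A B)" "v \<in> hom C (Dom C u) (prod_obj C A B)"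
    using assms by simp_all
  ultimately show ?thesis using assms(8,9) by (metis (no_types, lifting))
qed

text \<open>Both (A|G) and (X|Y|Z) are defined as kernels of pairings; this splits membership in
  such a kernel into two separate vanishing conditions.\<close>

lemma pair_comp_zero_iff:
  assumes f: "f \<in> Arr C" "g \<in> Arr C" "Dom C f = Dom C g" and x: "x \<in> Arr C" "Cod C x = Dom C f"
  shows "pair C f g \<cdot> x = zero_arr C (Dom C x) (prod_obj C (Cod C f) (Cod C g)) \<longleftrightarrow>
    f \<cdot> x = zero_arr C (Dom C x) (Cod C f) \<and> g \<cdot> x = zero_arr C (Dom C x) (Cod C g)"
proof -
  let ?P = "prod_obj C (Cod C f) (Cod C g)"
  have pr: "prj1 C (Cod C f) (Cod C g) \<in> hom C ?P (Cod C f)"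
     "prj2 C (Cod C f) (Cod C g) \<in> hom C ?P (Cod C g)"
    using prj1_hom prj2_hom f Cod_Obj by blast+
  have P: "?P \<in> Obj C" using pr Dom_Obj[of "prj1 C (Cod C f) (Cod C g)"] by simp
  have fx: "prj1 C (Cod C f) (Cod C g) \<cdot> (pair C f g \<cdot> x) = f \<cdot> x"
    "prj2 C (Cod C f) (Cod C g) \<cdot> (pair C f g \<cdot> x) = g \<cdot> x"
    by (rule comp_reduce; use f x pr in \<open>simp add: prj1_pair prj2_pair\<close>)+
  have zx: "prj1 C (Cod C f) (Cod C g) \<cdot> zero_arr C (Dom C x) ?P = zero_arr C (Dom C x) (Cod C f)"
    "prj2 C (Cod C f) (Cod C g) \<cdot> zero_arr C (Dom C x) ?P = zero_arr C (Dom C x) (Cod C g)"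
    using pr x by simp_all
  show ?thesis
  proof
    assume 0: "f \<cdot> x = zero_arr C (Dom C x) (Cod C f) \<and> g \<cdot> x = zero_arr C (Dom C x) (Cod C g)"
    show "pair C f g \<cdot> x = zero_arr C (Dom C x) ?P"
      by (rule prod_eqI[of _ _ "Cod C f" "Cod C g"]) (use 0 f x P fx zx in simp_all)
  next
    assume 0: "pair C f g \<cdot> x = zero_arr C (Dom C x) ?P"
    show "f \<cdot> x = zero_arr C (Dom C x) (Cod C f) \<and> g \<cdot> x = zero_arr C (Dom C x) (Cod C g)"
      using fx zx unfolding 0 by metis
  qed
qed

lemma copair_unique:
  assumes "f \<in> Arr C" "g \<in> Arr C" "Cod C f = Cod C g"
  shows "\<exists>!h. h \<in> hom C (sum_obj C (Dom C f) (Dom C g)) (Cod C f) \<and>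
        h \<cdot> inj1 C (Dom C f) (Dom C g) = f \<and> h \<cdot> inj2 C (Dom C f) (Dom C g) = g"
proof -
  have "is_coproduct C (Dom C f) (Dom C g) (sum_injs C (Dom C f) (Dom C g))"
    unfolding sum_injs_def by (rule someI_ex, rule coproduct_exists) (use assms in auto)
  then show ?thesis using assms
    unfolding is_coproduct_def inj1_def inj2_def sum_obj_def split_beta by simp
qed

lemma
  assumes "A \<in> Obj C" "B \<in> Obj C"
  shows inj1_Arr [simp]: "inj1 C A B \<in> Arr C"
    and inj2_Arr [simp]: "inj2 C A B \<in> Arr C"
    and Dom_inj1 [simp]: "Dom C (inj1 C A B) = A"
    and Dom_inj2 [simp]: "Dom C (inj2 C A B) = B"
    and Cod_inj1 [simp]: "Cod C (inj1 C A B) = sum_obj C A B"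
    and Cod_inj2 [simp]: "Cod C (inj2 C A B) = sum_obj C A B"
    and sum_Obj [simp]: "sum_obj C A B \<in> Obj C"
proof -
  have "is_coproduct C A B (sum_injs C A B)"
    unfolding sum_injs_def by (rule someI_ex, rule coproduct_exists) (use assms in auto)
  then show *: "inj1 C A B \<in> Arr C" "inj2 C A B \<in> Arr C"
    "Dom C (inj1 C A B) = A" "Dom C (inj2 C A B) = B"
    "Cod C (inj1 C A B) = sum_obj C A B" "Cod C (inj2 C A B) = sum_obj C A B"
    unfolding is_coproduct_def inj1_def inj2_def sum_obj_def split_beta by simp_all
  show "sum_obj C A B \<in> Obj C" using *(1,5) Cod_Obj by metis
qed

lemma
  assumes "f \<in> Arr C" "g \<in> Arr C" "Cod C f = Cod C g"
  shows copair_Arr [simp]: "copair C f g \<in> Arr C"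
    and Cod_copair [simp]: "Cod C (copair C f g) = Cod C f"
    and Dom_copair [simp]: "Dom C (copair C f g) = sum_obj C (Dom C f) (Dom C g)"
    and copair_inj1: "copair C f g \<cdot> inj1 C (Dom C f) (Dom C g) = f"
    and copair_inj2: "copair C f g \<cdot> inj2 C (Dom C f) (Dom C g) = g"
  using theI'[OF copair_unique[OF assms], folded copair_def] by simp_all

lemma
  assumes "f \<in> Arr C" "g \<in> Arr C" "Cod C f = Cod C g" "Dom C f = A" "Dom C g = B"
  shows copair_inj1' [simp]: "copair C f g \<cdot> inj1 C A B = f"
    and copair_inj2' [simp]: "copair C f g \<cdot> inj2 C A B = g"
    and copair_inj1_comp [simp]: "\<lbrakk>x \<in> Arr C; Cod C x = A\<rbrakk> \<Longrightarrow> copair C f g \<cdot> (inj1 C A B \<cdot> x) = f \<cdot> x"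
    and copair_inj2_comp [simp]: "\<lbrakk>x \<in> Arr C; Cod C x = B\<rbrakk> \<Longrightarrow> copair C f g \<cdot> (inj2 C A B \<cdot> x) = g \<cdot> x"
proof -
  show *: "copair C f g \<cdot> inj1 C A B = f" "copair C f g \<cdot> inj2 C A B = g"
    using copair_inj1 copair_inj2 assms by auto
  show "copair C f g \<cdot> (inj1 C A B \<cdot> x) = f \<cdot> x" if "x \<in> Arr C" "Cod C x = A"
    using assms that by (intro comp_reduce[OF *(1)]) auto
  show "copair C f g \<cdot> (inj2 C A B \<cdot> x) = g \<cdot> x" if "x \<in> Arr C" "Cod C x = B"
    using assms that by (intro comp_reduce[OF *(2)]) auto
qed

lemma sum_eqI:
  assumes "u \<in> Arr C" "v \<in> Arr C" "Dom C u = sum_obj C A B" "Dom C v = sum_obj C A B"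
    "A \<in> Obj C" "B \<in> Obj C"
    "u \<cdot> inj1 C A B = v \<cdot> inj1 C A B" "u \<cdot> inj2 C A B = v \<cdot> inj2 C A B"
  shows "u = v"
proof -
  let ?f = "u \<cdot> inj1 C A B" and ?g = "u \<cdot> inj2 C A B"
  have "Cod C (u \<cdot> inj1 C A B) = Cod C (v \<cdot> inj1 C A B)" using assms(7) by simp
  then have uv: "Cod C u = Cod C v" using assms(1-6) by simp
  have "\<exists>!h. h \<in> hom C (sum_obj C (Dom C ?f) (Dom C ?g)) (Cod C ?f) \<and>
      h \<cdot> inj1 C (Dom C ?f) (Dom C ?g) = ?f \<and> h \<cdot> inj2 C (Dom C ?f) (Dom C ?g) = ?g"
    by (rule copair_unique) (use assms(1-6) in simp_all)
  moreover have "Dom C ?f = A" "Dom C ?g = B" "Cod C ?f = Cod C u"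
    using assms(1-6) by simp_all
  ultimately have "\<exists>!h. h \<in> hom C (sum_obj C A B) (Cod C u) \<and>
      h \<cdot> inj1 C A B = ?f \<and> h \<cdot> inj2 C A B = ?g"
    by (simp only:)
  moreover have "u \<in> hom C (sum_obj C A B) (Cod C u)" "v \<in> hom C (sum_obj C A B) (Cod C u)"
    using assms(1-6) uv by simp_all
  ultimately show ?thesis using assms(7,8) by (metis (no_types, lifting))
qed

lemma comp_copair:
  assumes "f \<in> Arr C" "g \<in> Arr C" "Cod C f = Cod C g" "h \<in> Arr C" "Dom C h = Cod C f"
  shows "h \<cdot> copair C f g = copair C (h \<cdot> f) (h \<cdot> g)"
  by (rule sum_eqI[where A = "Dom C f" and B = "Dom C g"]) (use assms in simp_all)

lemma
  assumes "a \<in> Arr C" "b \<in> Arr C"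
  shows sum_map_Arr [simp]: "sum_map C a b \<in> Arr C"
    and Dom_sum_map [simp]: "Dom C (sum_map C a b) = sum_obj C (Dom C a) (Dom C b)"
    and Cod_sum_map [simp]: "Cod C (sum_map C a b) = sum_obj C (Cod C a) (Cod C b)"
  using assms by (simp_all add: sum_map_def)

lemma copair_sum_map:
  assumes "f \<in> Arr C" "g \<in> Arr C" "Cod C f = Cod C g" "a \<in> Arr C" "b \<in> Arr C"
    "Cod C a = Dom C f" "Cod C b = Dom C g"
  shows "copair C f g \<cdot> sum_map C a b = copair C (f \<cdot> a) (g \<cdot> b)"
  using assms by (simp add: sum_map_def comp_copair)

lemma
  assumes "A \<in> Obj C" "B \<in> Obj C"
  shows retr1_Arr [simp]: "retr1 C A B \<in> Arr C"
    and Dom_retr1 [simp]: "Dom C (retr1 C A B) = sum_obj C A B"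
    and Cod_retr1 [simp]: "Cod C (retr1 C A B) = A"
    and retr2_Arr [simp]: "retr2 C A B \<in> Arr C"
    and Dom_retr2 [simp]: "Dom C (retr2 C A B) = sum_obj C A B"
    and Cod_retr2 [simp]: "Cod C (retr2 C A B) = B"
    and retr1_inj1 [simp]: "retr1 C A B \<cdot> inj1 C A B = Ide C A"
    and retr1_inj2 [simp]: "retr1 C A B \<cdot> inj2 C A B = zero_arr C B A"
    and retr2_inj1 [simp]: "retr2 C A B \<cdot> inj1 C A B = zero_arr C A B"
    and retr2_inj2 [simp]: "retr2 C A B \<cdot> inj2 C A B = Ide C B"
  using assms by (simp_all add: retr1_def retr2_def)

section \<open>Monomorphisms, kernels and regular epimorphisms\<close>

text \<open>Domain and codomain are functions of the arrow, so an equation between composites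
  carries type information. Reading it off spares the cancellation rules below some typing
  premises.\<close>

lemma comp_eq_typing:
  assumes "g \<cdot> f = g' \<cdot> f'" "f \<in> Arr C" "g \<in> Arr C" "f' \<in> Arr C" "g' \<in> Arr C"
    "Dom C g = Cod C f" "Dom C g' = Cod C f'"
  shows "Dom C f = Dom C f'" "Cod C g = Cod C g'"
  using assms Dom_comp[of f g] Dom_comp[of f' g'] Cod_comp[of f g] Cod_comp[of f' g'] by simp_all

lemma comp_typing:
  assumes "g \<cdot> f = h" "f \<in> Arr C" "g \<in> Arr C" "Dom C g = Cod C f"
  shows "Dom C f = Dom C h" "Cod C g = Cod C h" "h \<in> Arr C"
  using assms by auto

definition monic :: "'m \<Rightarrow> bool" where
  "monic m \<longleftrightarrow> m \<in> Arr C \<and>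
     (\<forall>x y. x \<in> Arr C \<and> y \<in> Arr C \<and> Dom C x = Dom C y \<and> Cod C x = Dom C m \<and> Cod C y = Dom C m \<and>
        m \<cdot> x = m \<cdot> y \<longrightarrow> x = y)"

lemma monic_Arr: "monic m \<Longrightarrow> m \<in> Arr C"
  by (simp add: monic_def)

lemma monicI:
  assumes "m \<in> Arr C"
    and "\<And>x y. \<lbrakk>x \<in> Arr C; y \<in> Arr C; Dom C x = Dom C y; Cod C x = Dom C m; Cod C y = Dom C m;
      m \<cdot> x = m \<cdot> y\<rbrakk> \<Longrightarrow> x = y"
  shows "monic m"
  unfolding monic_def using assms by blast

lemma monicD:
  assumes "monic m" "m \<cdot> x = m \<cdot> y"
    "x \<in> Arr C" "y \<in> Arr C" "Cod C x = Dom C m" "Cod C y = Dom C m"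
  shows "x = y"
proof -
  have "Dom C x = Dom C y"
    by (rule comp_eq_typing(1)[OF assms(2)]) (use assms monic_Arr[OF assms(1)] in simp_all)
  then show ?thesis using assms unfolding monic_def by blast
qed

lemma lift_equality:
  assumes "monic m" "h \<in> Arr C" "Cod C h = Dom C m" "m \<cdot> h = f"
  shows "lift C m f = h"
proof -
  have f: "Dom C f = Dom C h" using assms monic_Arr by auto
  show ?thesis unfolding lift_def
  proof (rule the_equality)
    show "h \<in> hom C (Dom C f) (Dom C m) \<and> m \<cdot> h = f" using assms f by simp
    show "h' = h" if "h' \<in> hom C (Dom C f) (Dom C m) \<and> m \<cdot> h' = f" for h'
      by (rule monicD[OF assms(1)]) (use that assms in simp_all)
  qed
qed

lemma is_kernelD:
  assumes "is_kernel C f k"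
  shows "f \<in> Arr C" "k \<in> Arr C" "Cod C k = Dom C f" "f \<cdot> k = zero_arr C (Dom C k) (Cod C f)"
  using assms by (simp_all add: is_kernel_def)

lemma kernel_unique:
  assumes k: "is_kernel C f k" and x: "x \<in> Arr C"
    "Cod C x = Dom C f" "f \<cdot> x = zero_arr C (Dom C x) (Cod C f)"
  shows "\<exists>!h. h \<in> hom C (Dom C x) (Dom C k) \<and> k \<cdot> h = x"
proof -
  have "x \<in> hom C (Dom C x) (Dom C f)" using x by simp
  moreover have "\<forall>X. \<forall>x \<in> hom C X (Dom C f). f \<cdot> x = zero_arr C X (Cod C f) \<longrightarrow>
        (\<exists>!h. h \<in> hom C X (Dom C k) \<and> k \<cdot> h = x)"
    using k unfolding is_kernel_def by (elim conjE)
  ultimately show ?thesis using x(3) by blast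
qed

lemma kernel_factor:
  assumes "is_kernel C f k" "x \<in> Arr C" "Cod C x = Dom C f" "f \<cdot> x = zero_arr C (Dom C x) (Cod C f)"
  obtains h where "h \<in> Arr C" "Dom C h = Dom C x" "Cod C h = Dom C k" "k \<cdot> h = x"
  using ex1_implies_ex[OF kernel_unique[OF assms]]
  by (elim exE conjE) (rule that, unfold in_hom_iff, simp_all only:)

lemma kernel_monic:
  assumes k: "is_kernel C f k"
  shows "monic k"
proof (rule monicI)
  note [simp] = is_kernelD(1-3)[OF k]
  show "k \<in> Arr C" by simp
  fix x y assume xy: "x \<in> Arr C"
    "y \<in> Arr C" "Dom C x = Dom C y" "Cod C x = Dom C k" "Cod C y = Dom C k"
    "k \<cdot> x = k \<cdot> y"
  have "f \<cdot> (k \<cdot> x) = zero_arr C (Dom C k) (Cod C f) \<cdot> x"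
    by (rule comp_reduce) (use is_kernelD(4)[OF k] xy in simp_all)
  also have "\<dots> = zero_arr C (Dom C x) (Cod C f)" using xy by simp
  finally have "f \<cdot> (k \<cdot> x) = zero_arr C (Dom C (k \<cdot> x)) (Cod C f)" using xy by simp
  then have "\<exists>!h. h \<in> hom C (Dom C (k \<cdot> x)) (Dom C k) \<and> k \<cdot> h = k \<cdot> x"
    by - (rule kernel_unique[OF k]; use xy in simp_all)
  moreover have "x \<in> hom C (Dom C (k \<cdot> x)) (Dom C k) \<and> k \<cdot> x = k \<cdot> x"
    "y \<in> hom C (Dom C (k \<cdot> x)) (Dom C k) \<and> k \<cdot> y = k \<cdot> x" using xy by simp_all
  ultimately show "x = y" by (metis (no_types, lifting))
qed

text \<open>Uniqueness of factorizations follows from monicity and their domain from the equation,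
  so only a bare factorization has to be exhibited.\<close>

lemma is_kernelI:
  assumes "f \<in> Arr C" "monic k" "Cod C k = Dom C f" "f \<cdot> k = zero_arr C (Dom C k) (Cod C f)"
    and "\<And>x. \<lbrakk>x \<in> Arr C; Cod C x = Dom C f; f \<cdot> x = zero_arr C (Dom C x) (Cod C f)\<rbrakk>
      \<Longrightarrow> \<exists>h \<in> Arr C. Cod C h = Dom C k \<and> k \<cdot> h = x"
  shows "is_kernel C f k"
  unfolding is_kernel_def
proof (intro conjI allI ballI impI)
  fix X x assume x: "x \<in> hom C X (Dom C f)" "f \<cdot> x = zero_arr C X (Cod C f)"
  then obtain h where h: "h \<in> Arr C" "Cod C h = Dom C k" "k \<cdot> h = x" using assms(5)[of x] by auto
  have "Dom C h = Dom C x" by (rule comp_typing(1)[OF h(3,1) monic_Arr[OF assms(2)]]) (use h in simp_all)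
  then have "h \<in> hom C X (Dom C k)" using h x by simp
  then have "h \<in> hom C X (Dom C k) \<and> k \<cdot> h = x" using h by simp
  moreover have "h' = h" if "h' \<in> hom C X (Dom C k) \<and> k \<cdot> h' = x" for h'
    by (rule monicD[OF assms(2)]) (use that h in simp_all)
  ultimately show "\<exists>!h. h \<in> hom C X (Dom C k) \<and> k \<cdot> h = x" by (rule ex1I[of _ h])
qed (use assms monic_Arr in simp_all)

section \<open>Pullbacks, and kernels as pullbacks along zero arrows\<close>

lemma is_pullbackD:
  assumes "is_pullback C f g p q"
  shows "f \<in> Arr C" "g \<in> Arr C" "Cod C f = Cod C g" "p \<in> Arr C" "q \<in> Arr C"
    "Dom C q = Dom C p" "Cod C p = Dom C f" "Cod C q = Dom C g" "f \<cdot> p = g \<cdot> q"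
  using assms by (simp_all add: is_pullback_def)

lemma pullback_unique:
  assumes pb: "is_pullback C f g p q" and xy: "x \<in> Arr C" "y \<in> Arr C" "Dom C x = Dom C y"
    "Cod C x = Dom C f" "Cod C y = Dom C g" "f \<cdot> x = g \<cdot> y"
  shows "\<exists>!h. h \<in> hom C (Dom C x) (Dom C p) \<and> p \<cdot> h = x \<and> q \<cdot> h = y"
proof -
  have "x \<in> hom C (Dom C x) (Dom C f)" "y \<in> hom C (Dom C x) (Dom C g)" using xy by simp_all
  moreover have "\<forall>X. \<forall>x \<in> hom C X (Dom C f). \<forall>y \<in> hom C X (Dom C g). f \<cdot> x = g \<cdot> y \<longrightarrow>
        (\<exists>!h. h \<in> hom C X (Dom C p) \<and> p \<cdot> h = x \<and> q \<cdot> h = y)"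
    using pb unfolding is_pullback_def by (elim conjE)
  ultimately show ?thesis using xy(6) by blast
qed

lemma pullback_factor:
  assumes "is_pullback C f g p q" "x \<in> Arr C" "y \<in> Arr C" "Dom C x = Dom C y"
    "Cod C x = Dom C f" "Cod C y = Dom C g" "f \<cdot> x = g \<cdot> y"
  obtains h where "h \<in> Arr C" "Dom C h = Dom C x" "Cod C h = Dom C p" "p \<cdot> h = x" "q \<cdot> h = y"
  using ex1_implies_ex[OF pullback_unique[OF assms]]
  by (elim exE conjE) (rule that, unfold in_hom_iff, simp_all only:)

lemma pullback_eqI:
  assumes pb: "is_pullback C f g p q" and uv: "u \<in> Arr C" "v \<in> Arr C" "Cod C u = Dom C p"
    "Cod C v = Dom C p" "p \<cdot> u = p \<cdot> v" "q \<cdot> u = q \<cdot> v"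
  shows "u = v"
proof -
  note [simp] = is_pullbackD[OF pb]
  have dom: "Dom C u = Dom C v" by (rule comp_eq_typing(1)[OF uv(5)]) (use uv in simp_all)
  have "f \<cdot> (p \<cdot> u) = (g \<cdot> q) \<cdot> u" by (rule comp_reduce) (use uv in simp_all)
  then have "\<exists>!h. h \<in> hom C (Dom C (p \<cdot> u)) (Dom C p) \<and> p \<cdot> h = p \<cdot> u \<and> q \<cdot> h = q \<cdot> u"
    by - (rule pullback_unique[OF pb]; use uv in simp_all)
  moreover have "Dom C (p \<cdot> u) = Dom C u" using uv dom by simp
  moreover have "u \<in> hom C (Dom C u) (Dom C p) \<and> p \<cdot> u = p \<cdot> u \<and> q \<cdot> u = q \<cdot> u"
    "v \<in> hom C (Dom C u) (Dom C p) \<and> p \<cdot> v = p \<cdot> u \<and> q \<cdot> v = q \<cdot> u"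
      using uv dom by simp_all
  ultimately show ?thesis by (metis (no_types, lifting))
qed

text \<open>Pull \<open>f\<close> back along the zero arrow from a zero object: the second
  projection ends in a zero object and therefore imposes nothing on arrows into the
  pullback.\<close>

lemma kernel_exists:
  assumes f: "f \<in> Arr C"
  shows "\<exists>k. is_kernel C f k"
proof -
  obtain Z where Z: "is_zero_object C Z" by (rule zero_object_exists)
  then have [simp]: "Z \<in> Obj C" by (simp add: is_zero_object_def)
  obtain p q where pb: "is_pullback C f (zero_arr C Z (Cod C f)) p q"
    using pullback_exists[OF complete f, of "zero_arr C Z (Cod C f)"] f by auto
  note [simp] = is_pullbackD(4-8)[OF pb]
  have "is_kernel C f p"
  proof (rule is_kernelI)
    show "monic p"
    proof (rule monicI)
      fix x y assume xy: "x \<in> Arr C" "y \<in> Arr C" "Dom C x = Dom C y" "Cod C x = Dom C p"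
        "Cod C y = Dom C p" "p \<cdot> x = p \<cdot> y"
      have "q \<cdot> x = q \<cdot> y" by (rule zero_object_unique(1)[OF Z]) (use xy f in simp_all)
      then show "x = y" using xy by - (rule pullback_eqI[OF pb], simp_all)
    qed simp
    fix x assume x: "x \<in> Arr C" "Cod C x = Dom C f" "f \<cdot> x = zero_arr C (Dom C x) (Cod C f)"
    show "\<exists>h \<in> Arr C. Cod C h = Dom C p \<and> p \<cdot> h = x"
      by (rule pullback_factor[OF pb, of x "zero_arr C (Dom C x) Z"]) (use x f in auto)
  qed (use f is_pullbackD(9)[OF pb] in simp_all)
  then show ?thesis by blast
qed

lemma ker_is_kernel: "f \<in> Arr C \<Longrightarrow> is_kernel C f (ker C f)"
  unfolding ker_def by (rule someI_ex) (rule kernel_exists)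

text \<open>Protomodularity speaks of pullbacks of points. This identifies change of base along the
  arrow from a zero object with taking kernels.\<close>

lemma kernel_pullback:
  assumes Z: "is_zero_object C Z" and k: "is_kernel C f k"
  shows "is_pullback C f (zero_arr C Z (Cod C f)) k (zero_arr C (Dom C k) Z)"
  unfolding is_pullback_def
proof (intro conjI allI ballI impI)
  note [simp] = is_kernelD[OF k]
  have [simp]: "Z \<in> Obj C" using Z by (simp add: is_zero_object_def)
  show "f \<cdot> k = zero_arr C Z (Cod C f) \<cdot> zero_arr C (Dom C k) Z"
    "zero_arr C (Dom C k) Z \<in> hom C (Dom C k) (Dom C (zero_arr C Z (Cod C f)))"
    "zero_arr C Z (Cod C f) \<in> Arr C" "Cod C f = Cod C (zero_arr C Z (Cod C f))" by simp_all
  fix X x y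
  assume x: "x \<in> hom C X (Dom C f)" and y: "y \<in> hom C X (Dom C (zero_arr C Z (Cod C f)))"
    and e: "f \<cdot> x = zero_arr C Z (Cod C f) \<cdot> y"
  then have "f \<cdot> x = zero_arr C X (Cod C f)" by auto
  then have *: "\<exists>!h. h \<in> hom C X (Dom C k) \<and> k \<cdot> h = x"
    using kernel_unique[OF k, of x] x by auto
  have "zero_arr C (Dom C k) Z \<cdot> h = y" if "h \<in> hom C X (Dom C k)" for h
    by (rule zero_object_unique(1)[OF Z]) (use that y in auto)
  then show "\<exists>!h. h \<in> hom C X (Dom C k) \<and> k \<cdot> h = x \<and> zero_arr C (Dom C k) Z \<cdot> h = y"
    using * by (metis (no_types, lifting))
qed (use is_kernelD[OF k] in simp_all)

text \<open>Restricting \<open>p\<close> to a subobject \<open>m\<close> that contains both its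
  kernel and its section gives a point with the same kernel. Change of base to a zero object thus
  turns \<open>m\<close> into an identity, and protomodularity reflects this isomorphism back to
  \<open>m\<close>.\<close>

lemma point_monic_iso:
  assumes pt: "is_point C B p s" and k: "is_kernel C p k" and m: "monic m" "Cod C m = Dom C p"
    and k': "k' \<in> Arr C" "Cod C k' = Dom C m" "m \<cdot> k' = k"
    and t: "t \<in> Arr C" "Cod C t = Dom C m" "m \<cdot> t = s"
  shows "is_iso C m"
proof -
  obtain Z where Z: "is_zero_object C Z" by (rule zero_object_exists)
  then have [simp]: "Z \<in> Obj C" by (simp add: is_zero_object_def)
  note [simp] = is_kernelD(1-3)[OF k] monic_Arr[OF m(1)] m(2) k' t
  have [simp]: "Cod C p = B" "s \<in> Arr C" "Dom C s = B" "Cod C s = Dom C p" "p \<cdot> s = Ide C B"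
    using pt by (auto simp: is_point_def)
  have [simp]: "B \<in> Obj C" using Cod_Obj[of p] by simp
  have dk: "Dom C k' = Dom C k" using Dom_comp[of k' m] by simp
  have dt: "Dom C t = B" using Dom_comp[of t m] by simp
  have k'k: "is_kernel C (p \<cdot> m) k'"
  proof (rule is_kernelI)
    show "monic k'"
    proof (rule monicI)
      fix x y assume xy: "x \<in> Arr C"
        "y \<in> Arr C" "Cod C x = Dom C k'" "Cod C y = Dom C k'" "k' \<cdot> x = k' \<cdot> y"
      have "k \<cdot> x = m \<cdot> (k' \<cdot> x)" "k \<cdot> y = m \<cdot> (k' \<cdot> y)"
        by (rule comp_reduce[symmetric]; use xy in simp)+
      then show "x = y" using xy dk by - (rule monicD[OF kernel_monic[OF k]], simp_all)
    qed simp
    show "(p \<cdot> m) \<cdot> k' = zero_arr C (Dom C k') (Cod C (p \<cdot> m))"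
      using is_kernelD(4)[OF k] dk by simp
    fix x assume x: "x \<in> Arr C"
      "Cod C x = Dom C (p \<cdot> m)" "(p \<cdot> m) \<cdot> x = zero_arr C (Dom C x) (Cod C (p \<cdot> m))"
    obtain h where h: "h \<in> Arr C" "Dom C h = Dom C x" "Cod C h = Dom C k" "k \<cdot> h = m \<cdot> x"
      by (rule kernel_factor[OF k, of "m \<cdot> x"]) (use x in auto)
    have "m \<cdot> (k' \<cdot> h) = k \<cdot> h" by (rule comp_reduce) (use h dk in simp_all)
    then have "k' \<cdot> h = x" using h x dk by - (rule monicD[OF m(1)], simp_all)
    then show "\<exists>h \<in> Arr C. Cod C h = Dom C k' \<and> k' \<cdot> h = x" using h dk by auto
  qed simp_all
  let ?v = "zero_arr C Z B"
  have 1: "is_pullback C (p \<cdot> m) ?v k' (zero_arr C (Dom C k) Z)"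
    using kernel_pullback[OF Z k'k] dk by simp
  have 2: "is_pullback C p ?v k (zero_arr C (Dom C k) Z)"
    using kernel_pullback[OF Z k] by simp
  have 3: "is_point C (Cod C ?v) (p \<cdot> m) t"
    "is_point C (Cod C ?v) p s" "point_map C (p \<cdot> m) t p s m"
    using dt by (simp_all add: is_point_def point_map_def)
  \<comment> \<open>The image of \<open>m\<close> under change of base: the two points share their
    kernel, and the comparison between the kernels is the identity.\<close>
  have 4: "Ide C (Dom C k) \<in> hom C (Dom C (zero_arr C (Dom C k) Z)) (Dom C (zero_arr C (Dom C k) Z))"
    "k \<cdot> Ide C (Dom C k) = m \<cdot> k'"
    "zero_arr C (Dom C k) Z \<cdot> Ide C (Dom C k) = zero_arr C (Dom C k) Z" "is_iso C (Ide C (Dom C k))"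
    by (auto simp: is_iso_def intro!: bexI[of _ "Ide C (Dom C k)"])
  have v: "?v \<in> Arr C" by simp
  have "protomodular C" using homological by (simp add: homological_def)
  then have "\<forall>v \<in> Arr C. \<forall>p s p' s' h w q w' q' k.
        is_point C (Cod C v) p s \<and> is_point C (Cod C v) p' s' \<and> point_map C p s p' s' h \<and>
        is_pullback C p v w q \<and> is_pullback C p' v w' q' \<and>
        k \<in> hom C (Dom C q) (Dom C q') \<and> w' \<cdot> k = h \<cdot> w \<and> q' \<cdot> k = q \<and>
        is_iso C k \<longrightarrow> is_iso C h" unfolding protomodular_def by (rule conjunct2)
  from this[rule_format, OF v, of "p \<cdot> m" t p s m k' _ k _ "Ide C (Dom C k)"] 1 2 3 4
  show ?thesis by blast
qed

section \<open>Regular epimorphisms and their factorization with monomorphisms\<close>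

lemma is_coequalizerD:
  assumes "is_coequalizer C f g e"
  shows "f \<in> Arr C" "g \<in> Arr C"
    "Dom C g = Dom C f" "Cod C g = Cod C f" "e \<in> Arr C" "Dom C e = Cod C f"
    "e \<cdot> f = e \<cdot> g"
  using assms by (simp_all add: is_coequalizer_def)

lemma coequalizer_unique:
  assumes "is_coequalizer C f g e" "x \<in> Arr C" "Dom C x = Cod C f" "x \<cdot> f = x \<cdot> g"
  shows "\<exists>!u. u \<in> hom C (Cod C e) (Cod C x) \<and> u \<cdot> e = x"
proof -
  have "x \<in> hom C (Cod C f) (Cod C x)" using assms by simp
  moreover have "\<forall>X. \<forall>x \<in> hom C (Cod C f) X. x \<cdot> f = x \<cdot> g \<longrightarrow>
        (\<exists>!u. u \<in> hom C (Cod C e) X \<and> u \<cdot> e = x)"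
    using assms(1) unfolding is_coequalizer_def by (elim conjE)
  ultimately show ?thesis using assms(4) by blast
qed

lemma regular_epi_Arr: "regular_epi C e \<Longrightarrow> e \<in> Arr C"
  by (auto simp: regular_epi_def is_coequalizer_def)

lemma regular_epi_cancel:
  assumes e: "regular_epi C e" and uv: "u \<in> Arr C" "v \<in> Arr C" "Dom C u = Cod C e" "Dom C v = Cod C e"
    "u \<cdot> e = v \<cdot> e"
  shows "u = v"
proof -
  obtain f g where fg: "is_coequalizer C f g e" using e by (auto simp: regular_epi_def)
  note [simp] = is_coequalizerD(1-6)[OF fg]
  have cod: "Cod C u = Cod C v" by (rule comp_eq_typing(2)[OF uv(5)]) (use uv in simp_all)
  have "\<exists>!w. w \<in> hom C (Cod C e) (Cod C (u \<cdot> e)) \<and> w \<cdot> e = u \<cdot> e"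
    by (rule coequalizer_unique[OF fg]) (use uv is_coequalizerD(7)[OF fg] in simp_all)
  moreover have "Cod C (u \<cdot> e) = Cod C u" using uv cod by simp
  moreover have "u \<in> hom C (Cod C e) (Cod C u)" "v \<in> hom C (Cod C e) (Cod C u)"
    using uv cod by simp_all
  ultimately show ?thesis using uv(5) by (metis (no_types, lifting))
qed

lemma is_coequalizerI:
  assumes "f \<in> Arr C" "g \<in> Arr C"
    "Dom C g = Dom C f" "Cod C g = Cod C f" "e \<in> Arr C" "Dom C e = Cod C f"
    "e \<cdot> f = e \<cdot> g"
    and cancel: "\<And>u v. \<lbrakk>u \<in> Arr C; v \<in> Arr C; Dom C u = Cod C e; Dom C v = Cod C e; u \<cdot> e = v \<cdot> e\<rbrakk> \<Longrightarrow> u = v"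
    and ex: "\<And>x. \<lbrakk>x \<in> Arr C; Dom C x = Cod C f; x \<cdot> f = x \<cdot> g\<rbrakk> \<Longrightarrow> \<exists>u \<in> Arr C. Dom C u = Cod C e \<and> u \<cdot> e = x"
  shows "is_coequalizer C f g e"
  unfolding is_coequalizer_def
proof (intro conjI allI ballI impI)
  fix X x assume x: "x \<in> hom C (Cod C f) X" "x \<cdot> f = x \<cdot> g"
  then obtain u where u: "u \<in> Arr C" "Dom C u = Cod C e" "u \<cdot> e = x" using ex[of x] by auto
  have "Cod C u = Cod C x" by (rule comp_typing(2)[OF u(3) assms(5) u(1)]) (use u in simp_all)
  then have "u \<in> hom C (Cod C e) X \<and> u \<cdot> e = x" using u x by simp
  moreover have "u' = u" if "u' \<in> hom C (Cod C e) X \<and> u' \<cdot> e = x" for u'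
    by (rule cancel) (use that u in simp_all)
  ultimately show "\<exists>!u. u \<in> hom C (Cod C e) X \<and> u \<cdot> e = x" by (rule ex1I[of _ u])
qed (use assms in simp_all)

lemma iso_comp_regular_epi:
  assumes m: "is_iso C m" and r: "regular_epi C r" and mr: "Dom C m = Cod C r"
  shows "regular_epi C (m \<cdot> r)"
proof -
  obtain f g where fg: "is_coequalizer C f g r" using r by (auto simp: regular_epi_def)
  note [simp] = is_coequalizerD(1-6)[OF fg]
  obtain n where [simp]: "m \<in> Arr C" "n \<in> Arr C" "Dom C n = Cod C m" "Cod C n = Cod C r"
    and nm: "n \<cdot> m = Ide C (Cod C r)" "m \<cdot> n = Ide C (Cod C m)" using m mr
      by (auto simp: is_iso_def)
  have nmr: "n \<cdot> (m \<cdot> r) = r" using comp_reduce[OF nm(1), of r] mr by simp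
  have "is_coequalizer C f g (m \<cdot> r)"
  proof (rule is_coequalizerI)
    show "(m \<cdot> r) \<cdot> f = (m \<cdot> r) \<cdot> g" using is_coequalizerD(7)[OF fg] mr by simp
    fix x assume x: "x \<in> Arr C" "Dom C x = Cod C f" "x \<cdot> f = x \<cdot> g"
    obtain u where "u \<in> hom C (Cod C r) (Cod C x)" "u \<cdot> r = x"
      using ex1_implies_ex[OF coequalizer_unique[OF fg x]] by (elim exE conjE)
    then show "\<exists>u \<in> Arr C. Dom C u = Cod C (m \<cdot> r) \<and> u \<cdot> (m \<cdot> r) = x"
      using mr nmr by (intro bexI[of _ "u \<cdot> n"]) simp_all
  next
    fix u v assume uv: "u \<in> Arr C"
      "v \<in> Arr C" "Dom C u = Cod C (m \<cdot> r)" "Dom C v = Cod C (m \<cdot> r)"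
      "u \<cdot> (m \<cdot> r) = v \<cdot> (m \<cdot> r)"
    have "u \<cdot> m = v \<cdot> m" by (rule regular_epi_cancel[OF r]) (use uv mr in simp_all)
    then have "(u \<cdot> m) \<cdot> n = (v \<cdot> m) \<cdot> n" by simp
    then show "u = v" using uv mr nm by simp
  qed (use mr in simp_all)
  then show ?thesis by (auto simp: regular_epi_def)
qed

lemma regular: "regular_category C"
  using homological by (simp add: homological_def)

lemma regular_epi_pullback: "\<lbrakk>is_pullback C f g p q; regular_epi C f\<rbrakk> \<Longrightarrow> regular_epi C q"
  using regular unfolding regular_category_def by blast

text \<open>The kernel pair of \<open>f\<close> is the kernel pair of its coequalizer \<open>r\<close>, so two arrows identified by
  the comparison \<open>m\<close> already agree after pulling them back along \<open>r\<close>.\<close>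

lemma regular_epi_monic_factorization:
  assumes f: "f \<in> Arr C"
  obtains m r where "monic m" "regular_epi C r" "Cod C r = Dom C m" "m \<cdot> r = f"
proof -
  obtain p q where pq: "is_pullback C f f p q" using pullback_exists[OF complete f f] by auto
  then obtain r where r: "is_coequalizer C p q r" using regular unfolding regular_category_def by blast
  note [simp] = is_pullbackD(2,4-8)[OF pq] is_coequalizerD(5)[OF r] is_coequalizerD(6)[OF r]
  obtain m where [simp]: "m \<in> Arr C" "Dom C m = Cod C r" "Cod C m = Cod C f" and mr: "m \<cdot> r = f"
    using ex1_implies_ex[OF coequalizer_unique[OF r f _ is_pullbackD(9)[OF pq]]] by auto
  have regr: "regular_epi C r" using r by (auto simp: regular_epi_def)
  have "monic m"
  proof (rule monicI)
    fix a b assume ab: "a \<in> Arr C" "b \<in> Arr C" and dom: "Dom C a = Dom C b"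
      and ab': "Cod C a = Dom C m" "Cod C b = Dom C m" "m \<cdot> a = m \<cdot> b"
    note ab = ab ab'
    \<comment> \<open>The regular epimorphism \<open>w\<close> covers the common domain so that
      \<open>a \<cdot> w\<close> lifts along \<open>r\<close> to \<open>a'\<close>; the refinement
      \<open>v\<close> makes \<open>b\<close> liftable as well. Both covers are cancelled at the
      end.\<close>
    obtain a' w where w: "is_pullback C r a a' w" using pullback_exists[OF complete, of r a] ab by auto
    note [simp] = is_pullbackD(4-8)[OF w]
    obtain b' v where v: "is_pullback C r (b \<cdot> w) b' v"
      using pullback_exists[OF complete, of r "b \<cdot> w"] ab dom by auto
    note [simp] = is_pullbackD(4-8)[OF v]
    have [simp]: "Dom C (b \<cdot> w) = Dom C w" "Cod C v = Dom C w"
      using ab dom is_pullbackD(8)[OF v] by simp_all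
    have ra: "r \<cdot> (a' \<cdot> v) = a \<cdot> (w \<cdot> v)"
      using comp_reduce[OF is_pullbackD(9)[OF w], of v] ab by simp
    have rb: "r \<cdot> b' = b \<cdot> (w \<cdot> v)" using is_pullbackD(9)[OF v] ab dom by simp
    have "f \<cdot> (a' \<cdot> v) = m \<cdot> (r \<cdot> (a' \<cdot> v))"
      by (rule comp_reduce[OF mr, symmetric]) simp_all
    also have "\<dots> = (m \<cdot> a) \<cdot> (w \<cdot> v)" using ra ab(1-4) dom by simp
    also have "\<dots> = (m \<cdot> b) \<cdot> (w \<cdot> v)" by (simp only: ab(5))
    also have "\<dots> = m \<cdot> (r \<cdot> b')" using rb ab(1-4) dom by simp
    also have "\<dots> = f \<cdot> b'" by (rule comp_reduce[OF mr]) simp_all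
    finally have "f \<cdot> (a' \<cdot> v) = f \<cdot> b'" .
    then obtain h where h: "h \<in> Arr C" "Cod C h = Dom C p" "p \<cdot> h = a' \<cdot> v" "q \<cdot> h = b'"
      by (rule pullback_factor[OF pq, rotated 5]) auto
    have "a \<cdot> (w \<cdot> v) = r \<cdot> (p \<cdot> h)" using ra h by simp
    also have "\<dots> = r \<cdot> (q \<cdot> h)"
      using comp_reduce[OF is_coequalizerD(7)[OF r], of h] h by simp
    also have "\<dots> = b \<cdot> (w \<cdot> v)" using rb h by simp
    finally have "(a \<cdot> w) \<cdot> v = (b \<cdot> w) \<cdot> v" using ab dom by simp
    then have "a \<cdot> w = b \<cdot> w"
      using ab dom by - (rule regular_epi_cancel[OF regular_epi_pullback[OF v regr]], simp_all)
    then show "a = b"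
      using ab dom by - (rule regular_epi_cancel[OF regular_epi_pullback[OF w regr]], simp_all)
  qed simp
  then show thesis using that regr mr by simp
qed

section \<open>Split epimorphisms are covered by their kernel and section\<close>

lemma is_pointD:
  assumes "is_point C B p s"
  shows "p \<in> Arr C" "Cod C p = B"
    "s \<in> Arr C" "Dom C s = B" "Cod C s = Dom C p" "p \<cdot> s = Ide C B" "B \<in> Obj C"
  using assms Cod_Obj[of p] by (auto simp: is_point_def)

text \<open>In the factorization \<open>m \<cdot> r\<close> of the copairing, kernel and section
  both factor through the monomorphism \<open>m\<close>, so \<open>m\<close> is an isomorphism by
  \<open>point_monic_iso\<close> and only the regular epimorphism \<open>r\<close> remains.\<close>

lemma point_copair_regular_epi:
  assumes pt: "is_point C B p s" and k: "is_kernel C p k"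
  shows "regular_epi C (copair C k s)"
proof -
  note [simp] = is_pointD[OF pt] is_kernelD(1-3)[OF k]
  have "copair C k s \<in> Arr C" by simp
  then obtain m r where m: "monic m"
    and r: "regular_epi C r" and mr: "Cod C r = Dom C m" "m \<cdot> r = copair C k s"
    by (rule regular_epi_monic_factorization)
  note [simp] = monic_Arr[OF m] regular_epi_Arr[OF r]
  have "Cod C (m \<cdot> r) = Dom C p" "Dom C (m \<cdot> r) = sum_obj C (Dom C k) B" using mr by simp_all
  then have d: "Cod C m = Dom C p" "Dom C r = sum_obj C (Dom C k) B" using mr(1) by simp_all
  have "m \<cdot> (r \<cdot> inj1 C (Dom C k) B) = copair C k s \<cdot> inj1 C (Dom C k) B"
    by (rule comp_reduce[OF mr(2)]) (use mr(1) d in simp_all)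
  moreover have "m \<cdot> (r \<cdot> inj2 C (Dom C k) B) = copair C k s \<cdot> inj2 C (Dom C k) B"
    by (rule comp_reduce[OF mr(2)]) (use mr(1) d in simp_all)
  ultimately have "is_iso C m"
    by - (rule point_monic_iso[OF pt k m, of "r \<cdot> inj1 C (Dom C k) B"
      "r \<cdot> inj2 C (Dom C k) B"]; use mr(1) d in simp_all)
  then show ?thesis using iso_comp_regular_epi[OF _ r, of m] mr by metis
qed

text \<open>The form in which protomodularity serves to test equations: on TA, on kernel pairs and
  on cross-effects of sums alike.\<close>

lemma point_jointly_epic:
  assumes pt: "is_point C B p s" and k: "is_kernel C p k"
    and uv: "u \<in> Arr C" "v \<in> Arr C"
      "Dom C u = Dom C p" "Dom C v = Dom C p" "u \<cdot> k = v \<cdot> k" "u \<cdot> s = v \<cdot> s"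
  shows "u = v"
proof (rule regular_epi_cancel[OF point_copair_regular_epi[OF pt k]])
  note [simp] = is_pointD[OF pt] is_kernelD(1-3)[OF k]
  show "u \<cdot> copair C k s = v \<cdot> copair C k s" using uv by (simp add: comp_copair)
qed (use uv is_pointD[OF pt] is_kernelD(1-3)[OF k] in simp_all)

text \<open>Two arrows out of the kernel pair of \<open>e\<close> agree as soon as they agree on the diagonal and on the
  kernel of the first projection, which is a copy of the kernel of \<open>e\<close>.\<close>

lemma regular_epi_cokernel:
  assumes e: "regular_epi C e" and k: "is_kernel C e k"
    and x: "x \<in> Arr C" "Dom C x = Dom C e" "x \<cdot> k = zero_arr C (Dom C k) (Cod C x)"
  obtains u where "u \<in> Arr C" "Dom C u = Cod C e" "Cod C u = Cod C x" "u \<cdot> e = x"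
proof -
  obtain f g where fg: "is_coequalizer C f g e" using e by (auto simp: regular_epi_def)
  note [simp] = is_coequalizerD(1-5)[OF fg] is_kernelD(2,3)[OF k] x(1,2)
  have cf: "Cod C f = Dom C e" using is_coequalizerD(6)[OF fg] by simp
  obtain p q where pq: "is_pullback C e e p q" using pullback_exists[OF complete, of e e] by auto
  note [simp] = is_pullbackD(4-8)[OF pq]
  obtain \<Delta> where \<Delta>: "\<Delta> \<in> Arr C"
    "Dom C \<Delta> = Dom C e" "Cod C \<Delta> = Dom C p" "p \<cdot> \<Delta> = Ide C (Dom C e)" "q \<cdot> \<Delta> = Ide C (Dom C e)"
    by (rule pullback_factor[OF pq, of "Ide C (Dom C e)" "Ide C (Dom C e)"]) auto
  obtain l where l [simp]: "l \<in> Arr C" "Dom C l = Dom C k" "Cod C l = Dom C p"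
    and pl: "p \<cdot> l = zero_arr C (Dom C k) (Dom C e)" and ql: "q \<cdot> l = k"
    by (rule pullback_factor[OF pq, of "zero_arr C (Dom C k) (Dom C e)" k])
      (use is_kernelD(4)[OF k] in auto)
  have pt: "is_point C (Dom C e) p \<Delta>" using \<Delta> by (simp add: is_point_def)
  have lk: "is_kernel C p l"
  proof (rule is_kernelI)
    show "monic l"
    proof (rule monicI)
      fix y z assume yz: "y \<in> Arr C"
        "z \<in> Arr C" "Cod C y = Dom C l" "Cod C z = Dom C l" "l \<cdot> y = l \<cdot> z"
      have "k \<cdot> y = q \<cdot> (l \<cdot> y)" "k \<cdot> z = q \<cdot> (l \<cdot> z)"
        by (rule comp_reduce[OF ql, symmetric]; use yz in simp)+
      then show "y = z" using yz by - (rule monicD[OF kernel_monic[OF k]], simp_all)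
    qed simp
    fix y assume y: "y \<in> Arr C" "Cod C y = Dom C p" "p \<cdot> y = zero_arr C (Dom C y) (Cod C p)"
    have "e \<cdot> (q \<cdot> y) = (e \<cdot> p) \<cdot> y"
      using comp_reduce[OF is_pullbackD(9)[OF pq], of y] y by simp
    also have "\<dots> = zero_arr C (Dom C y) (Cod C e)" using y by simp
    finally have "e \<cdot> (q \<cdot> y) = zero_arr C (Dom C (q \<cdot> y)) (Cod C e)" using y by simp
    then obtain h where h: "h \<in> Arr C"
      "Dom C h = Dom C (q \<cdot> y)" "Cod C h = Dom C k" "k \<cdot> h = q \<cdot> y"
      by (rule kernel_factor[OF k, rotated 2]) (use y in auto)
    have "l \<cdot> h = y"
    proof (rule pullback_eqI[OF pq])
      have "p \<cdot> (l \<cdot> h) = zero_arr C (Dom C k) (Dom C e) \<cdot> h"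
        by (rule comp_reduce[OF pl]) (use h in simp_all)
      then show "p \<cdot> (l \<cdot> h) = p \<cdot> y" using h y by simp
      have "q \<cdot> (l \<cdot> h) = k \<cdot> h" by (rule comp_reduce[OF ql]) (use h in simp_all)
      then show "q \<cdot> (l \<cdot> h) = q \<cdot> y" using h by simp
    qed (use h y in simp_all)
    then show "\<exists>h \<in> Arr C. Cod C h = Dom C l \<and> l \<cdot> h = y" using h by auto
  qed (use pl in simp_all)
  \<comment> \<open>On \<open>\<Delta>\<close> both sides are \<open>x\<close>. On \<open>l\<close>
    the left side vanishes because \<open>p \<cdot> l\<close> does, and the right side is
    \<open>x \<cdot> k\<close>, zero by assumption.\<close>
  have "x \<cdot> p = x \<cdot> q"
    by (rule point_jointly_epic[OF pt lk]) (use x(3) pl ql \<Delta> in simp_all)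
  \<comment> \<open>\<open>e\<close> is only known to coequalize some pair \<open>f\<close>,
    \<open>g\<close>. That pair factors through the kernel pair by \<open>w\<close>, so
    \<open>x\<close> coequalizes it too.\<close>
  moreover obtain w where w: "w \<in> Arr C" "Cod C w = Dom C p" "p \<cdot> w = f" "q \<cdot> w = g"
    by (rule pullback_factor[OF pq, of f g]) (use is_coequalizerD(7)[OF fg] cf in auto)
  ultimately have "x \<cdot> f = x \<cdot> g"
    using comp_reduce[of x p "x \<cdot> q" w] by auto
  then obtain u where "u \<in> hom C (Cod C e) (Cod C x)" "u \<cdot> e = x"
    using ex1_implies_ex[OF coequalizer_unique[OF fg, of x]] cf by auto
  then show thesis by (intro that) simp_all
qed

text \<open>If \<open>e\<close> coequalizes \<open>f\<close> and \<open>g\<close>, then e + 1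
  coequalizes f + 1 and g + 1: on the first summand this is the universal property of
  \<open>e\<close>, and on the second all arrows are identities.\<close>

lemma regular_epi_sum_map:
  assumes e: "regular_epi C e" and G: "G \<in> Obj C"
  shows "regular_epi C (sum_map C e (Ide C G))"
proof -
  obtain f g where fg: "is_coequalizer C f g e" using e by (auto simp: regular_epi_def)
  note [simp] = is_coequalizerD(1-5)[OF fg] G
  have cf: "Cod C f = Dom C e" using is_coequalizerD(6)[OF fg] by simp
  have "is_coequalizer C (sum_map C f (Ide C G)) (sum_map C g (Ide C G)) (sum_map C e (Ide C G))"
  proof (rule is_coequalizerI)
    show "sum_map C e (Ide C G) \<cdot> sum_map C f (Ide C G) = sum_map C e (Ide C G) \<cdot> sum_map C g (Ide C G)"
      using is_coequalizerD(7)[OF fg] cf by (simp add: sum_map_def[of C e] copair_sum_map)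
  next
    fix u v assume uv: "u \<in> Arr C"
      "v \<in> Arr C" "Dom C u = Cod C (sum_map C e (Ide C G))" "Dom C v = Cod C (sum_map C e (Ide C G))"
      and eq: "u \<cdot> sum_map C e (Ide C G) = v \<cdot> sum_map C e (Ide C G)"
    have "(u \<cdot> sum_map C e (Ide C G)) \<cdot> inj1 C (Dom C e) G = (v \<cdot> sum_map C e (Ide C G)) \<cdot> inj1 C (Dom C e) G"
      "(u \<cdot> sum_map C e (Ide C G)) \<cdot> inj2 C (Dom C e) G = (v \<cdot> sum_map C e (Ide C G)) \<cdot> inj2 C (Dom C e) G"
      by (simp_all only: eq)
    then have eq': "u \<cdot> (inj1 C (Cod C e) G \<cdot> e) = v \<cdot> (inj1 C (Cod C e) G \<cdot> e)"
      "u \<cdot> inj2 C (Cod C e) G = v \<cdot> inj2 C (Cod C e) G" using uv by (simp_all add: sum_map_def)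
    show "u = v"
    proof (rule sum_eqI)
      show "u \<cdot> inj1 C (Cod C e) G = v \<cdot> inj1 C (Cod C e) G"
        by (rule regular_epi_cancel[OF e]) (use uv eq' in simp_all)
    qed (use uv eq' in simp_all)
  next
    fix x assume x: "x \<in> Arr C" "Dom C x = Cod C (sum_map C f (Ide C G))"
      and eq: "x \<cdot> sum_map C f (Ide C G) = x \<cdot> sum_map C g (Ide C G)"
    have "(x \<cdot> sum_map C f (Ide C G)) \<cdot> inj1 C (Dom C f) G = (x \<cdot> sum_map C g (Ide C G)) \<cdot> inj1 C (Dom C f) G"
      by (simp only: eq)
    then have "(x \<cdot> inj1 C (Dom C e) G) \<cdot> f = (x \<cdot> inj1 C (Dom C e) G) \<cdot> g"
      using x cf by (simp add: sum_map_def)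
    then obtain u where u: "u \<in> Arr C"
      "Dom C u = Cod C e" "Cod C u = Cod C x" "u \<cdot> e = x \<cdot> inj1 C (Dom C e) G"
      using ex1_implies_ex[OF coequalizer_unique[OF fg, of "x \<cdot> inj1 C (Dom C e) G"]] x cf by auto
    have "copair C u (x \<cdot> inj2 C (Dom C e) G) \<cdot> sum_map C e (Ide C G) = x"
      by (rule sum_eqI[of _ _ "Dom C e" G]) (use u x cf in \<open>simp_all add: copair_sum_map\<close>)
    then show "\<exists>u \<in> Arr C. Dom C u = Cod C (sum_map C e (Ide C G)) \<and> u \<cdot> sum_map C e (Ide C G) = x"
      using u x cf by (intro bexI[of _ "copair C u (x \<cdot> inj2 C (Dom C e) G)"]) simp_all
  qed (use cf in simp_all)
  then show ?thesis by (auto simp: regular_epi_def)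
qed

section \<open>Cross-effects\<close>

lemma lift_factor:
  assumes "monic m" "h \<in> Arr C" "Cod C h = Dom C m" "m \<cdot> h = f"
  shows "lift C m f \<in> Arr C"
    "Dom C (lift C m f) = Dom C f" "Cod C (lift C m f) = Dom C m" "m \<cdot> lift C m f = f"
  using assms monic_Arr[OF assms(1)] unfolding lift_equality[OF assms] by auto

lemma kernel_lift:
  assumes k: "is_kernel C f k" and x: "x \<in> Arr C"
    "Cod C x = Dom C f" "f \<cdot> x = zero_arr C (Dom C x) (Cod C f)"
  shows "lift C k x \<in> Arr C"
    "Dom C (lift C k x) = Dom C x" "Cod C (lift C k x) = Dom C k" "k \<cdot> lift C k x = x"
proof -
  obtain h where "h \<in> Arr C" "Cod C h = Dom C k" "k \<cdot> h = x" by (rule kernel_factor[OF k x])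
  note lift_factor[OF kernel_monic[OF k] this]
  then show "lift C k x \<in> Arr C"
    "Dom C (lift C k x) = Dom C x" "Cod C (lift C k x) = Dom C k" "k \<cdot> lift C k x = x"
    by blast+
qed

lemma cr2_kernel:
  assumes "A \<in> Obj C" "B \<in> Obj C"
  shows "is_kernel C (pair C (retr1 C A B) (retr2 C A B)) (cr2_incl C A B)"
  unfolding cr2_incl_def by (rule ker_is_kernel) (use assms in simp)

lemma
  assumes "A \<in> Obj C" "B \<in> Obj C"
  shows cr2_incl_Arr [simp]: "cr2_incl C A B \<in> Arr C"
    and Dom_cr2_incl [simp]: "Dom C (cr2_incl C A B) = cr2 C A B"
    and Cod_cr2_incl [simp]: "Cod C (cr2_incl C A B) = sum_obj C A B"
    and cr2_Obj [simp]: "cr2 C A B \<in> Obj C"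
    and cr2_incl_monic: "monic (cr2_incl C A B)"
proof -
  note k = cr2_kernel[OF assms]
  show *: "cr2_incl C A B \<in> Arr C"
    "Dom C (cr2_incl C A B) = cr2 C A B" "Cod C (cr2_incl C A B) = sum_obj C A B"
    using is_kernelD[OF k] assms by (simp_all add: cr2_def)
  show "cr2 C A B \<in> Obj C" using *(1) by (simp add: cr2_def)
  show "monic (cr2_incl C A B)" by (rule kernel_monic[OF k])
qed

lemma
  assumes [simp]: "A \<in> Obj C" "B \<in> Obj C"
  shows retr1_cr2_incl [simp]: "retr1 C A B \<cdot> cr2_incl C A B = zero_arr C (cr2 C A B) A"
    and retr2_cr2_incl [simp]: "retr2 C A B \<cdot> cr2_incl C A B = zero_arr C (cr2 C A B) B"
  using is_kernelD(4)[OF cr2_kernel[OF assms]]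
    pair_comp_zero_iff[of "retr1 C A B" "retr2 C A B" "cr2_incl C A B"]
  by simp_all

lemma cr2_lift:
  assumes [simp]: "A \<in> Obj C" "B \<in> Obj C"
    and x: "x \<in> Arr C" "Cod C x = sum_obj C A B"
      "retr1 C A B \<cdot> x = zero_arr C (Dom C x) A" "retr2 C A B \<cdot> x = zero_arr C (Dom C x) B"
  shows "lift C (cr2_incl C A B) x \<in> Arr C" "Dom C (lift C (cr2_incl C A B) x) = Dom C x"
    "Cod C (lift C (cr2_incl C A B) x) = cr2 C A B" "cr2_incl C A B \<cdot> lift C (cr2_incl C A B) x = x"
proof -
  have "pair C (retr1 C A B) (retr2 C A B) \<cdot> x
      = zero_arr C (Dom C x) (Cod C (pair C (retr1 C A B) (retr2 C A B)))"
    using pair_comp_zero_iff[of "retr1 C A B" "retr2 C A B" x] x by simp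
  from kernel_lift[OF cr2_kernel[OF assms(1,2)] x(1) _ this]
  show "lift C (cr2_incl C A B) x \<in> Arr C" "Dom C (lift C (cr2_incl C A B) x) = Dom C x"
    "Cod C (lift C (cr2_incl C A B) x) = cr2 C A B" "cr2_incl C A B \<cdot> lift C (cr2_incl C A B) x = x"
    using x by simp_all
qed

lemma
  assumes [simp]: "a \<in> Arr C" "b \<in> Arr C"
  shows retr1_sum_map: "retr1 C (Cod C a) (Cod C b) \<cdot> sum_map C a b = a \<cdot> retr1 C (Dom C a) (Dom C b)"
    and retr2_sum_map: "retr2 C (Cod C a) (Cod C b) \<cdot> sum_map C a b = b \<cdot> retr2 C (Dom C a) (Dom C b)"
  by (simp_all add: retr1_def retr2_def copair_sum_map comp_copair)

lemma
  assumes [simp]: "a \<in> Arr C" "b \<in> Arr C"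
  shows cr2_map_Arr [simp]: "cr2_map C a b \<in> Arr C"
    and Dom_cr2_map [simp]: "Dom C (cr2_map C a b) = cr2 C (Dom C a) (Dom C b)"
    and Cod_cr2_map [simp]: "Cod C (cr2_map C a b) = cr2 C (Cod C a) (Cod C b)"
    and cr2_incl_cr2_map: "cr2_incl C (Cod C a) (Cod C b) \<cdot> cr2_map C a b
      = sum_map C a b \<cdot> cr2_incl C (Dom C a) (Dom C b)"
proof -
  let ?x = "sum_map C a b \<cdot> cr2_incl C (Dom C a) (Dom C b)"
  have "retr1 C (Cod C a) (Cod C b) \<cdot> ?x = (a \<cdot> retr1 C (Dom C a) (Dom C b)) \<cdot> cr2_incl C (Dom C a) (Dom C b)"
    by (rule comp_reduce[OF retr1_sum_map]) simp_all
  moreover have "retr2 C (Cod C a) (Cod C b) \<cdot> ?x = (b \<cdot> retr2 C (Dom C a) (Dom C b)) \<cdot> cr2_incl C (Dom C a) (Dom C b)"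
    by (rule comp_reduce[OF retr2_sum_map]) simp_all
  ultimately show "cr2_map C a b \<in> Arr C" "Dom C (cr2_map C a b) = cr2 C (Dom C a) (Dom C b)"
    "Cod C (cr2_map C a b) = cr2 C (Cod C a) (Cod C b)"
    "cr2_incl C (Cod C a) (Cod C b) \<cdot> cr2_map C a b = ?x"
    unfolding cr2_map_def using cr2_lift[of "Cod C a" "Cod C b" ?x] by simp_all
qed

text \<open>The computation rule for (a|b): after inclusion into the sum it is absorbed into the
  components of a copairing.\<close>

lemma copair_cr2_map:
  assumes [simp]: "f \<in> Arr C" "g \<in> Arr C" "Cod C f = Cod C g" "a \<in> Arr C" "b \<in> Arr C"
    and ab: "Dom C f = Cod C a" "Dom C g = Cod C b"
  shows "copair C f g \<cdot> (cr2_incl C (Cod C a) (Cod C b) \<cdot> cr2_map C a b)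
    = copair C (f \<cdot> a) (g \<cdot> b) \<cdot> cr2_incl C (Dom C a) (Dom C b)"
proof -
  have "copair C f g \<cdot> (sum_map C a b \<cdot> cr2_incl C (Dom C a) (Dom C b))
    = copair C (f \<cdot> a) (g \<cdot> b) \<cdot> cr2_incl C (Dom C a) (Dom C b)"
    by (rule comp_reduce[OF copair_sum_map]) (simp_all add: ab)
  then show ?thesis by (simp add: cr2_incl_cr2_map)
qed

lemma cr2_eqI:
  assumes "u \<in> Arr C" "v \<in> Arr C"
    "Cod C u = cr2 C A B" "Cod C v = cr2 C A B" "A \<in> Obj C" "B \<in> Obj C"
    "cr2_incl C A B \<cdot> u = cr2_incl C A B \<cdot> v"
  shows "u = v"
  by (rule monicD[OF cr2_incl_monic[of A B]]) (use assms in simp_all)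

lemma cr2_map_comp:
  assumes [simp]: "a \<in> Arr C" "b \<in> Arr C" "a' \<in> Arr C" "b' \<in> Arr C"
    and ab: "Dom C a' = Cod C a" "Dom C b' = Cod C b"
  shows "cr2_map C a' b' \<cdot> cr2_map C a b = cr2_map C (a' \<cdot> a) (b' \<cdot> b)"
proof (rule cr2_eqI[of _ _ "Cod C a'" "Cod C b'"])
  note [simp] = ab
  have "cr2_incl C (Cod C a') (Cod C b') \<cdot> (cr2_map C a' b' \<cdot> cr2_map C a b)
    = (sum_map C a' b' \<cdot> cr2_incl C (Cod C a) (Cod C b)) \<cdot> cr2_map C a b"
    by (rule comp_reduce) (simp_all add: cr2_incl_cr2_map)
  also have "\<dots> = copair C (inj1 C (Cod C a') (Cod C b') \<cdot> (a' \<cdot> a)) (inj2 C (Cod C a') (Cod C b') \<cdot> (b' \<cdot> b))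
      \<cdot> cr2_incl C (Dom C a) (Dom C b)"
    by (simp add: sum_map_def copair_cr2_map)
  also have "\<dots> = cr2_incl C (Cod C a') (Cod C b') \<cdot> cr2_map C (a' \<cdot> a) (b' \<cdot> b)"
    using cr2_incl_cr2_map[of "a' \<cdot> a" "b' \<cdot> b"] by (simp add: sum_map_def)
  finally show "cr2_incl C (Cod C a') (Cod C b') \<cdot> (cr2_map C a' b' \<cdot> cr2_map C a b)
    = cr2_incl C (Cod C a') (Cod C b') \<cdot> cr2_map C (a' \<cdot> a) (b' \<cdot> b)" .
qed (simp_all add: ab)

lemma cr2_map_Ide:
  assumes [simp]: "A \<in> Obj C" "B \<in> Obj C"
  shows "cr2_map C (Ide C A) (Ide C B) = Ide C (cr2 C A B)"
proof (rule cr2_eqI[of _ _ A B])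
  have "sum_map C (Ide C A) (Ide C B) = Ide C (sum_obj C A B)"
    by (rule sum_eqI[of _ _ A B]) (simp_all add: sum_map_def)
  then show "cr2_incl C A B \<cdot> cr2_map C (Ide C A) (Ide C B) = cr2_incl C A B \<cdot> Ide C (cr2 C A B)"
    using cr2_incl_cr2_map[of "Ide C A" "Ide C B"] by simp
qed simp_all

text \<open>The map 0 + b factors through the second retraction, and that retraction vanishes on the
  cross-effect.\<close>

lemma cr2_map_zero:
  assumes [simp]: "A \<in> Obj C" "A' \<in> Obj C" "b \<in> Arr C"
  shows "cr2_map C (zero_arr C A A') b = zero_arr C (cr2 C A (Dom C b)) (cr2 C A' (Cod C b))"
proof (rule cr2_eqI[of _ _ A' "Cod C b"])
  let ?i = "inj2 C A' (Cod C b) \<cdot> b"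
  have *: "sum_map C (zero_arr C A A') b = ?i \<cdot> retr2 C A (Dom C b)"
    by (rule sum_eqI[of _ _ A "Dom C b"]) (simp_all add: sum_map_def)
  have "(?i \<cdot> retr2 C A (Dom C b)) \<cdot> cr2_incl C A (Dom C b) = zero_arr C (cr2 C A (Dom C b)) (sum_obj C A' (Cod C b))"
    by simp
  then show "cr2_incl C A' (Cod C b) \<cdot> cr2_map C (zero_arr C A A') b
    = cr2_incl C A' (Cod C b) \<cdot> zero_arr C (cr2 C A (Dom C b)) (cr2 C A' (Cod C b))"
    using cr2_incl_cr2_map[of "zero_arr C A A'" b] unfolding * by simp
qed simp_all

text \<open>\<open>(X|Z)\<close> splits off \<open>(X + Y|Z)\<close>, then \<open>(Y|Z)\<close> splits off the complementary
  kernel, and \<open>(X|Y|Z)\<close> is what remains.\<close>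

lemma cr3_jointly_epic:
  assumes [simp]: "X \<in> Obj C" "Y \<in> Obj C" "Z \<in> Obj C"
    and uv: "u \<in> Arr C" "v \<in> Arr C"
      "Dom C u = cr2 C (sum_obj C X Y) Z" "Dom C v = cr2 C (sum_obj C X Y) Z"
    and 1: "u \<cdot> cr2_map C (inj1 C X Y) (Ide C Z) = v \<cdot> cr2_map C (inj1 C X Y) (Ide C Z)"
    and 2: "u \<cdot> cr2_map C (inj2 C X Y) (Ide C Z) = v \<cdot> cr2_map C (inj2 C X Y) (Ide C Z)"
    and 3: "u \<cdot> cr3_incl C X Y Z = v \<cdot> cr3_incl C X Y Z"
  shows "u = v"
proof -
  let ?p1 = "cr2_map C (retr1 C X Y) (Ide C Z)" and ?p2 = "cr2_map C (retr2 C X Y) (Ide C Z)"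
  let ?s1 = "cr2_map C (inj1 C X Y) (Ide C Z)" and ?s2 = "cr2_map C (inj2 C X Y) (Ide C Z)"
  let ?i = "cr3_incl C X Y Z"
  have i: "is_kernel C (pair C ?p1 ?p2) ?i"
    unfolding cr3_incl_def by (rule ker_is_kernel) simp
  have [simp]: "?i \<in> Arr C" "Cod C ?i = cr2 C (sum_obj C X Y) Z" using is_kernelD[OF i] by simp_all
  have pi: "?p1 \<cdot> ?i = zero_arr C (Dom C ?i) (cr2 C X Z)"
    "?p2 \<cdot> ?i = zero_arr C (Dom C ?i) (cr2 C Y Z)"
    using is_kernelD(4)[OF i] pair_comp_zero_iff[of ?p1 ?p2 ?i] by simp_all
  have pt1: "is_point C (cr2 C X Z) ?p1 ?s1" and p2s2: "?p2 \<cdot> ?s2 = Ide C (cr2 C Y Z)"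
    and p1s2: "?p1 \<cdot> ?s2 = zero_arr C (cr2 C Y Z) (cr2 C X Z)"
    by (simp_all add: is_point_def cr2_map_comp cr2_map_Ide cr2_map_zero)
  obtain k where k: "is_kernel C ?p1 k" using kernel_exists[of ?p1] by auto
  have [simp]: "k \<in> Arr C" "Cod C k = cr2 C (sum_obj C X Y) Z" using is_kernelD[OF k] by simp_all
  \<comment> \<open>Since \<open>?p1\<close> kills \<open>?s2\<close>, the section of
    \<open>?p2\<close> factors through \<open>k\<close>; hence \<open>?p2\<close> stays split after
    restriction to the kernel of \<open>?p1\<close>.\<close>
  obtain t where t: "t \<in> Arr C" "Dom C t = cr2 C Y Z" "Cod C t = Dom C k" "k \<cdot> t = ?s2"
    by (rule kernel_factor[OF k, of ?s2]) (use p1s2 in simp_all)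
  obtain l where l: "l \<in> Arr C" "Dom C l = Dom C ?i" "Cod C l = Dom C k" "k \<cdot> l = ?i"
    by (rule kernel_factor[OF k, of ?i]) (use pi in simp_all)
  have pt2: "is_point C (cr2 C Y Z) (?p2 \<cdot> k) t" using t p2s2 by (simp add: is_point_def)
  have lk: "is_kernel C (?p2 \<cdot> k) l"
  proof (rule is_kernelI)
    show "monic l"
    proof (rule monicI)
      fix x y assume xy: "x \<in> Arr C"
        "y \<in> Arr C" "Dom C x = Dom C y" "Cod C x = Dom C l" "Cod C y = Dom C l"
        "l \<cdot> x = l \<cdot> y"
      have "?i \<cdot> x = k \<cdot> (l \<cdot> x)" "?i \<cdot> y = k \<cdot> (l \<cdot> y)"
        by (rule comp_reduce[OF l(4), symmetric]; use xy l in simp)+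
      then show "x = y" using xy l by - (rule monicD[OF kernel_monic[OF i]], simp_all)
    qed (use l in simp)
    fix x assume x: "x \<in> Arr C"
      "Cod C x = Dom C (?p2 \<cdot> k)" "(?p2 \<cdot> k) \<cdot> x = zero_arr C (Dom C x) (Cod C (?p2 \<cdot> k))"
    have "?p1 \<cdot> (k \<cdot> x) = zero_arr C (Dom C k) (cr2 C X Z) \<cdot> x"
      by (rule comp_reduce) (use is_kernelD(4)[OF k] x in simp_all)
    then have "pair C ?p1 ?p2 \<cdot> (k \<cdot> x) = zero_arr C (Dom C (k \<cdot> x)) (Cod C (pair C ?p1 ?p2))"
      using pair_comp_zero_iff[of ?p1 ?p2 "k \<cdot> x"] x by simp
    then obtain h where h: "h \<in> Arr C"
      "Dom C h = Dom C (k \<cdot> x)" "Cod C h = Dom C ?i" "?i \<cdot> h = k \<cdot> x"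
      by (rule kernel_factor[OF i, rotated 2]) (use x in auto)
    have "k \<cdot> (l \<cdot> h) = ?i \<cdot> h" by (rule comp_reduce[OF l(4)]) (use l h in simp_all)
    then have "l \<cdot> h = x" using l h x by - (rule monicD[OF kernel_monic[OF k]], simp_all)
    then show "\<exists>h \<in> Arr C. Cod C h = Dom C l \<and> l \<cdot> h = x" using h l by auto
  qed (use l pi in simp_all)
  \<comment> \<open>Agreement on \<open>t\<close> and \<open>l\<close>, that is on (Y|Z) and
    (X|Y|Z), settles the kernel of \<open>?p1\<close>. Agreement on (X|Z) then settles the whole
    object.\<close>
  have "u \<cdot> k = v \<cdot> k"
    by (rule point_jointly_epic[OF pt2 lk]) (use uv t l 2 3 in simp_all)
  then show ?thesis
    by - (rule point_jointly_epic[OF pt1 k], use uv 1 in simp_all)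
qed

section \<open>Conjugation\<close>

text \<open>Rewrites conjugations and the right side of equation (1) as copairings restricted to a
  cross-effect, the shape in which they can be compared.\<close>

lemma c2_cr2_map:
  assumes [simp]: "f \<in> Arr C" "g \<in> Arr C" "Cod C f = E" "Cod C g = E"
  shows "c2 C E \<cdot> cr2_map C f g = copair C f g \<cdot> cr2_incl C (Dom C f) (Dom C g)"
proof -
  have [simp]: "E \<in> Obj C" using Cod_Obj[of f] by simp
  show ?thesis using copair_cr2_map[of "Ide C E" "Ide C E" f g] by (simp add: c2_def)
qed

text \<open>If \<open>n\<close> is a kernel of \<open>h\<close>, then h \<langle>n,1\<rangle> equals
  h followed after the second retraction, because \<open>h \<cdot> n\<close> is zero. The retraction
  vanishes on the cross-effect, so the conjugation lands in the kernel.\<close>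

lemma conj_act:
  assumes n: "is_kernel C h n"
  shows "conj_act C n \<in> hom C (cr2 C (Dom C n) (Cod C n)) (Dom C n)"
    and "n \<cdot> conj_act C n = copair C n (Ide C (Cod C n)) \<cdot> cr2_incl C (Dom C n) (Cod C n)"
proof -
  note [simp] = is_kernelD(1,2)[OF n]
  have d: "Dom C h = Cod C n" using is_kernelD(3)[OF n] by simp
  let ?x = "copair C n (Ide C (Cod C n)) \<cdot> cr2_incl C (Dom C n) (Cod C n)"
  have "h \<cdot> copair C n (Ide C (Cod C n)) = h \<cdot> retr2 C (Dom C n) (Cod C n)"
    using is_kernelD(4)[OF n] d by (simp add: comp_copair retr2_def)
  then have "h \<cdot> ?x = (h \<cdot> retr2 C (Dom C n) (Cod C n)) \<cdot> cr2_incl C (Dom C n) (Cod C n)"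
    by (rule comp_reduce) (simp_all add: d)
  then have "h \<cdot> ?x = zero_arr C (Dom C ?x) (Cod C h)" by (simp add: d)
  note * = kernel_lift[OF n _ _ this]
  have "conj_act C n = lift C n ?x" by (simp add: conj_act_def c2_cr2_map)
  then show "conj_act C n \<in> hom C (cr2 C (Dom C n) (Cod C n)) (Dom C n)" "n \<cdot> conj_act C n = ?x"
    using * d by simp_all
qed

lemma conj_act_restrict:
  assumes n: "is_kernel C h n" and g: "g \<in> Arr C" "Cod C g = Cod C n"
  shows "conj_act C n \<cdot> cr2_map C (Ide C (Dom C n)) g \<in> hom C (cr2 C (Dom C n) (Dom C g)) (Dom C n)"
    and "n \<cdot> (conj_act C n \<cdot> cr2_map C (Ide C (Dom C n)) g) = copair C n g \<cdot> cr2_incl C (Dom C n) (Dom C g)"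
proof -
  note [simp] = is_kernelD(2)[OF n] g
  have [simp]: "conj_act C n \<in> Arr C" "Dom C (conj_act C n) = cr2 C (Dom C n) (Cod C n)"
    "Cod C (conj_act C n) = Dom C n" using conj_act(1)[OF n] by simp_all
  show "conj_act C n \<cdot> cr2_map C (Ide C (Dom C n)) g \<in> hom C (cr2 C (Dom C n) (Dom C g)) (Dom C n)" by simp
  have "n \<cdot> (conj_act C n \<cdot> cr2_map C (Ide C (Dom C n)) g)
      = (copair C n (Ide C (Cod C n)) \<cdot> cr2_incl C (Dom C n) (Cod C n)) \<cdot> cr2_map C (Ide C (Dom C n)) g"
    by (rule comp_reduce[OF conj_act(2)[OF n]]) simp_all
  also have "\<dots> = copair C n g \<cdot> cr2_incl C (Dom C n) (Dom C g)"
    using copair_cr2_map[of n "Ide C (Cod C n)" "Ide C (Dom C n)" g] by simp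
  finally show "n \<cdot> (conj_act C n \<cdot> cr2_map C (Ide C (Dom C n)) g) = copair C n g \<cdot> cr2_incl C (Dom C n) (Dom C g)" .
qed

lemma
  assumes [simp]: "A \<in> Obj C" "G \<in> Obj C"
  shows conj_cr2_1_hom: "conj_cr2_1 C A G \<in> hom C (cr2 C (cr2 C A G) A) (cr2 C A G)"
    and conj_cr2_1: "cr2_incl C A G \<cdot> conj_cr2_1 C A G = copair C (cr2_incl C A G) (inj1 C A G) \<cdot> cr2_incl C (cr2 C A G) A"
    and conj_cr2_2_hom: "conj_cr2_2 C A G \<in> hom C (cr2 C (cr2 C A G) G) (cr2 C A G)"
    and conj_cr2_2: "cr2_incl C A G \<cdot> conj_cr2_2 C A G = copair C (cr2_incl C A G) (inj2 C A G) \<cdot> cr2_incl C (cr2 C A G) G"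
  using conj_act_restrict[OF cr2_kernel[OF assms], of "inj1 C A G"]
    conj_act_restrict[OF cr2_kernel[OF assms], of "inj2 C A G"]
  by (simp_all add: conj_cr2_1_def conj_cr2_2_def del: assoc)

section \<open>The monad\<close>

lemma T_kernel:
  assumes "A \<in> Obj C" "G \<in> Obj C"
  shows "is_kernel C (retr2 C A G) (T_incl C G A)"
  unfolding T_incl_def by (rule ker_is_kernel) (use assms in simp)

lemma
  assumes "A \<in> Obj C" "G \<in> Obj C"
  shows T_incl_Arr [simp]: "T_incl C G A \<in> Arr C"
    and Dom_T_incl [simp]: "Dom C (T_incl C G A) = T_obj C G A"
    and Cod_T_incl [simp]: "Cod C (T_incl C G A) = sum_obj C A G"
    and T_Obj [simp]: "T_obj C G A \<in> Obj C"
    and retr2_T_incl [simp]: "retr2 C A G \<cdot> T_incl C G A = zero_arr C (T_obj C G A) G"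
    and T_incl_monic: "monic (T_incl C G A)"
proof -
  note k = T_kernel[OF assms]
  show *: "T_incl C G A \<in> Arr C"
    "Dom C (T_incl C G A) = T_obj C G A" "Cod C (T_incl C G A) = sum_obj C A G"
    "retr2 C A G \<cdot> T_incl C G A = zero_arr C (T_obj C G A) G"
    using is_kernelD[OF k] assms by (simp_all add: T_obj_def)
  show "T_obj C G A \<in> Obj C" using *(1) by (simp add: T_obj_def)
  show "monic (T_incl C G A)" by (rule kernel_monic[OF k])
qed

lemma T_eqI:
  assumes "u \<in> Arr C" "v \<in> Arr C"
    "Cod C u = T_obj C G A" "Cod C v = T_obj C G A" "A \<in> Obj C" "G \<in> Obj C"
    "T_incl C G A \<cdot> u = T_incl C G A \<cdot> v"
  shows "u = v"
  by (rule monicD[OF T_incl_monic[of A G]]) (use assms in simp_all)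

lemma T_lift:
  assumes [simp]: "A \<in> Obj C" "G \<in> Obj C"
    and x: "x \<in> Arr C" "Cod C x = sum_obj C A G" "retr2 C A G \<cdot> x = zero_arr C (Dom C x) G"
  shows "lift C (T_incl C G A) x \<in> Arr C" "Dom C (lift C (T_incl C G A) x) = Dom C x"
    "Cod C (lift C (T_incl C G A) x) = T_obj C G A" "T_incl C G A \<cdot> lift C (T_incl C G A) x = x"
  using kernel_lift[OF T_kernel[OF assms(1,2)], of x] x by simp_all

lemma
  assumes [simp]: "A \<in> Obj C" "G \<in> Obj C"
  shows T_unit_Arr [simp]: "T_unit C G A \<in> Arr C"
    and Dom_T_unit [simp]: "Dom C (T_unit C G A) = A"
    and Cod_T_unit [simp]: "Cod C (T_unit C G A) = T_obj C G A"
    and T_incl_unit: "T_incl C G A \<cdot> T_unit C G A = inj1 C A G"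
    and j_incl_Arr [simp]: "j_incl C A G \<in> Arr C"
    and Dom_j_incl [simp]: "Dom C (j_incl C A G) = cr2 C A G"
    and Cod_j_incl [simp]: "Cod C (j_incl C A G) = T_obj C G A"
    and T_incl_j: "T_incl C G A \<cdot> j_incl C A G = cr2_incl C A G"
  unfolding T_unit_def j_incl_def using T_lift[of A G "inj1 C A G"] T_lift[of A G "cr2_incl C A G"]
  by simp_all

lemma
  assumes [simp]: "a \<in> Arr C" "G \<in> Obj C"
  shows T_map_Arr [simp]: "T_map C G a \<in> Arr C"
    and Dom_T_map [simp]: "Dom C (T_map C G a) = T_obj C G (Dom C a)"
    and Cod_T_map [simp]: "Cod C (T_map C G a) = T_obj C G (Cod C a)"
    and T_incl_T_map: "T_incl C G (Cod C a) \<cdot> T_map C G a = sum_map C a (Ide C G) \<cdot> T_incl C G (Dom C a)"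
proof -
  let ?x = "sum_map C a (Ide C G) \<cdot> T_incl C G (Dom C a)"
  have "retr2 C (Cod C a) G \<cdot> ?x = (Ide C G \<cdot> retr2 C (Dom C a) G) \<cdot> T_incl C G (Dom C a)"
    using retr2_sum_map[of a "Ide C G"] by (intro comp_reduce) simp_all
  then show "T_map C G a \<in> Arr C" "Dom C (T_map C G a) = T_obj C G (Dom C a)"
    "Cod C (T_map C G a) = T_obj C G (Cod C a)"
    "T_incl C G (Cod C a) \<cdot> T_map C G a = ?x"
    unfolding T_map_def using T_lift[of "Cod C a" G ?x] by simp_all
qed

lemma
  assumes [simp]: "A \<in> Obj C" "G \<in> Obj C"
  shows T_mult_Arr [simp]: "T_mult C G A \<in> Arr C"
    and Dom_T_mult [simp]: "Dom C (T_mult C G A) = T_obj C G (T_obj C G A)"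
    and Cod_T_mult [simp]: "Cod C (T_mult C G A) = T_obj C G A"
    and T_incl_T_mult: "T_incl C G A \<cdot> T_mult C G A
      = copair C (T_incl C G A) (inj2 C A G) \<cdot> T_incl C G (T_obj C G A)"
proof -
  let ?x = "copair C (T_incl C G A) (inj2 C A G) \<cdot> T_incl C G (T_obj C G A)"
  have "retr2 C A G \<cdot> copair C (T_incl C G A) (inj2 C A G) = retr2 C (T_obj C G A) G"
    by (simp add: comp_copair retr2_def[of C "T_obj C G A"])
  then have "retr2 C A G \<cdot> ?x = retr2 C (T_obj C G A) G \<cdot> T_incl C G (T_obj C G A)"
    by (rule comp_reduce) simp_all
  then show "T_mult C G A \<in> Arr C" "Dom C (T_mult C G A) = T_obj C G (T_obj C G A)"
    "Cod C (T_mult C G A) = T_obj C G A" "T_incl C G A \<cdot> T_mult C G A = ?x"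
    unfolding T_mult_def using T_lift[of A G ?x] by simp_all
qed

lemma T_map_unit:
  assumes [simp]: "a \<in> Arr C" "G \<in> Obj C"
  shows "T_map C G a \<cdot> T_unit C G (Dom C a) = T_unit C G (Cod C a) \<cdot> a"
proof (rule T_eqI[of _ _ G "Cod C a"])
  have "T_incl C G (Cod C a) \<cdot> (T_map C G a \<cdot> T_unit C G (Dom C a))
      = (sum_map C a (Ide C G) \<cdot> T_incl C G (Dom C a)) \<cdot> T_unit C G (Dom C a)"
    by (rule comp_reduce[OF T_incl_T_map]) simp_all
  also have "\<dots> = inj1 C (Cod C a) G \<cdot> a" by (simp add: T_incl_unit sum_map_def)
  also have "\<dots> = T_incl C G (Cod C a) \<cdot> (T_unit C G (Cod C a) \<cdot> a)"
    by (rule comp_reduce[OF T_incl_unit, symmetric]) simp_all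
  finally show "T_incl C G (Cod C a) \<cdot> (T_map C G a \<cdot> T_unit C G (Dom C a))
    = T_incl C G (Cod C a) \<cdot> (T_unit C G (Cod C a) \<cdot> a)" .
qed simp_all

lemma T_map_j:
  assumes [simp]: "a \<in> Arr C" "G \<in> Obj C"
  shows "T_map C G a \<cdot> j_incl C (Dom C a) G = j_incl C (Cod C a) G \<cdot> cr2_map C a (Ide C G)"
proof (rule T_eqI[of _ _ G "Cod C a"])
  have "T_incl C G (Cod C a) \<cdot> (T_map C G a \<cdot> j_incl C (Dom C a) G)
      = (sum_map C a (Ide C G) \<cdot> T_incl C G (Dom C a)) \<cdot> j_incl C (Dom C a) G"
    by (rule comp_reduce[OF T_incl_T_map]) simp_all
  also have "\<dots> = cr2_incl C (Cod C a) G \<cdot> cr2_map C a (Ide C G)"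
    using cr2_incl_cr2_map[of a "Ide C G"] by (simp add: T_incl_j)
  also have "\<dots> = T_incl C G (Cod C a) \<cdot> (j_incl C (Cod C a) G \<cdot> cr2_map C a (Ide C G))"
    by (rule comp_reduce[OF T_incl_j, symmetric]) simp_all
  finally show "T_incl C G (Cod C a) \<cdot> (T_map C G a \<cdot> j_incl C (Dom C a) G)
    = T_incl C G (Cod C a) \<cdot> (j_incl C (Cod C a) G \<cdot> cr2_map C a (Ide C G))" .
qed simp_all

text \<open>The monad law that lets associativity of an algebra hold automatically on the image of
  the unit.\<close>

lemma T_mult_unit:
  assumes [simp]: "A \<in> Obj C" "G \<in> Obj C"
  shows "T_mult C G A \<cdot> T_unit C G (T_obj C G A) = Ide C (T_obj C G A)"
proof (rule T_eqI[of _ _ G A])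
  have "T_incl C G A \<cdot> (T_mult C G A \<cdot> T_unit C G (T_obj C G A))
      = (copair C (T_incl C G A) (inj2 C A G) \<cdot> T_incl C G (T_obj C G A)) \<cdot> T_unit C G (T_obj C G A)"
    by (rule comp_reduce[OF T_incl_T_mult]) simp_all
  then show "T_incl C G A \<cdot> (T_mult C G A \<cdot> T_unit C G (T_obj C G A)) = T_incl C G A \<cdot> Ide C (T_obj C G A)"
    by (simp add: T_incl_unit)
qed simp_all

lemma T_point:
  assumes [simp]: "A \<in> Obj C" "G \<in> Obj C"
  shows "is_point C A (retr1 C A G \<cdot> T_incl C G A) (T_unit C G A)"
  by (simp add: is_point_def T_incl_unit)

text \<open>An arrow into TA already vanishes under the retraction onto G. If it also vanishes under
  the one onto A, it lies in the kernel of A + G -> A x G, which is (A|G).\<close>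

lemma j_kernel:
  assumes [simp]: "A \<in> Obj C" "G \<in> Obj C"
  shows "is_kernel C (retr1 C A G \<cdot> T_incl C G A) (j_incl C A G)"
proof (rule is_kernelI)
  have ix: "T_incl C G A \<cdot> (j_incl C A G \<cdot> x) = cr2_incl C A G \<cdot> x" if "x \<in> Arr C"
    "Cod C x = cr2 C A G" for x
    by (rule comp_reduce[OF T_incl_j]) (use that in simp_all)
  show "monic (j_incl C A G)"
  proof (rule monicI)
    fix x y assume xy: "x \<in> Arr C"
      "y \<in> Arr C" "Cod C x = Dom C (j_incl C A G)" "Cod C y = Dom C (j_incl C A G)"
      "j_incl C A G \<cdot> x = j_incl C A G \<cdot> y"
    show "x = y"
      by (rule cr2_eqI[of _ _ A G]) (use xy ix[of x] ix[of y] in simp_all)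
  qed simp
  fix x assume x: "x \<in> Arr C" "Cod C x = Dom C (retr1 C A G \<cdot> T_incl C G A)"
    "(retr1 C A G \<cdot> T_incl C G A) \<cdot> x = zero_arr C (Dom C x) (Cod C (retr1 C A G \<cdot> T_incl C G A))"
  have "retr2 C A G \<cdot> (T_incl C G A \<cdot> x) = zero_arr C (T_obj C G A) G \<cdot> x"
    by (rule comp_reduce) (use x in simp_all)
  then have *: "lift C (cr2_incl C A G) (T_incl C G A \<cdot> x) \<in> Arr C"
    "Cod C (lift C (cr2_incl C A G) (T_incl C G A \<cdot> x)) = cr2 C A G"
    "cr2_incl C A G \<cdot> lift C (cr2_incl C A G) (T_incl C G A \<cdot> x) = T_incl C G A \<cdot> x"
    using cr2_lift[of A G "T_incl C G A \<cdot> x"] x by simp_all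
  have "j_incl C A G \<cdot> lift C (cr2_incl C A G) (T_incl C G A \<cdot> x) = x"
    by (rule T_eqI[of _ _ G A]) (use x * ix in simp_all)
  then show "\<exists>h \<in> Arr C. Cod C h = Dom C (j_incl C A G) \<and> j_incl C A G \<cdot> h = x"
    using * by auto
qed (simp_all add: T_incl_j)

lemma T_jointly_epic:
  assumes [simp]: "A \<in> Obj C" "G \<in> Obj C"
    and "u \<in> Arr C" "v \<in> Arr C" "Dom C u = T_obj C G A" "Dom C v = T_obj C G A"
    "u \<cdot> j_incl C A G = v \<cdot> j_incl C A G" "u \<cdot> T_unit C G A = v \<cdot> T_unit C G A"
  shows "u = v"
  by (rule point_jointly_epic[OF T_point[OF assms(1,2)] j_kernel[OF assms(1,2)]]) (use assms in simp_all)

text \<open>Followed by the retraction onto A, the copairing \<langle>k,i_G\<rangle> is zero on G,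
  hence factors through the first retraction of TA + G and vanishes on (TA|G). So the conjugation by
  G lands in the kernel of TA -> A, which is \<open>j_incl C A G\<close>.\<close>

lemma
  assumes [simp]: "A \<in> Obj C" "G \<in> Obj C"
  shows conj_T'_hom: "conj_T' C A G \<in> hom C (cr2 C (T_obj C G A) G) (cr2 C A G)"
    and conj_T': "cr2_incl C A G \<cdot> conj_T' C A G
      = copair C (T_incl C G A) (inj2 C A G) \<cdot> cr2_incl C (T_obj C G A) G"
proof -
  have c [simp]: "conj_T C A G \<in> Arr C" "Dom C (conj_T C A G) = cr2 C (T_obj C G A) G"
    "Cod C (conj_T C A G) = T_obj C G A"
    and kc: "T_incl C G A \<cdot> conj_T C A G = copair C (T_incl C G A) (inj2 C A G) \<cdot> cr2_incl C (T_obj C G A) G"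
    using conj_act_restrict[OF T_kernel[OF assms], of "inj2 C A G"] by (simp_all add: conj_T_def del: assoc)
  have r: "retr1 C A G \<cdot> copair C (T_incl C G A) (inj2 C A G) = (retr1 C A G \<cdot> T_incl C G A) \<cdot> retr1 C (T_obj C G A) G"
    by (simp add: comp_copair retr1_def[of C "T_obj C G A"])
  have "(retr1 C A G \<cdot> T_incl C G A) \<cdot> conj_T C A G = retr1 C A G \<cdot> (T_incl C G A \<cdot> conj_T C A G)" by simp
  also have "\<dots> = ((retr1 C A G \<cdot> T_incl C G A) \<cdot> retr1 C (T_obj C G A) G) \<cdot> cr2_incl C (T_obj C G A) G"
    unfolding kc by (rule comp_reduce[OF r]) simp_all
  also have "\<dots> = zero_arr C (cr2 C (T_obj C G A) G) A" by simp
  finally have "(retr1 C A G \<cdot> T_incl C G A) \<cdot> conj_T C A G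
    = zero_arr C (Dom C (conj_T C A G)) (Cod C (retr1 C A G \<cdot> T_incl C G A))" by simp
  note l = kernel_lift[OF j_kernel[OF assms] _ _ this, folded conj_T'_def]
  show h: "conj_T' C A G \<in> hom C (cr2 C (T_obj C G A) G) (cr2 C A G)" using l by simp
  have jc: "j_incl C A G \<cdot> conj_T' C A G = conj_T C A G" using l by simp
  have "T_incl C G A \<cdot> (j_incl C A G \<cdot> conj_T' C A G) = cr2_incl C A G \<cdot> conj_T' C A G"
    by (rule comp_reduce[OF T_incl_j]) (use h in simp_all)
  then show "cr2_incl C A G \<cdot> conj_T' C A G
      = copair C (T_incl C G A) (inj2 C A G) \<cdot> cr2_incl C (T_obj C G A) G"
    using jc kc by simp
qed

text \<open>Te is the pullback of e + 1 along the inclusion of T into the sum: e + 1 respects the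
  retractions onto G, so an arrow that e + 1 sends into their kernel already lies in the kernel
  upstairs.\<close>

lemma regular_epi_T_map:
  assumes e: "regular_epi C e" and [simp]: "G \<in> Obj C"
  shows "regular_epi C (T_map C G e)"
proof -
  note [simp] = regular_epi_Arr[OF e]
  let ?k = "T_incl C G (Dom C e)" and ?l = "T_incl C G (Cod C e)" and ?e = "sum_map C e (Ide C G)"
  have "is_pullback C ?e ?l ?k (T_map C G e)"
    unfolding is_pullback_def
  proof (intro conjI allI ballI impI)
    show "?e \<cdot> ?k = ?l \<cdot> T_map C G e" by (simp add: T_incl_T_map)
    fix X x y assume x: "x \<in> hom C X (Dom C ?e)"
      and y: "y \<in> hom C X (Dom C ?l)" and xy: "?e \<cdot> x = ?l \<cdot> y"
    have "retr2 C (Cod C e) G \<cdot> (?e \<cdot> x) = (Ide C G \<cdot> retr2 C (Dom C e) G) \<cdot> x"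
      by (rule comp_reduce) (use x retr2_sum_map[of e "Ide C G"] in simp_all)
    moreover have "retr2 C (Cod C e) G \<cdot> (?l \<cdot> y) = zero_arr C (T_obj C G (Cod C e)) G \<cdot> y"
      by (rule comp_reduce) (use y in simp_all)
    ultimately have "retr2 C (Dom C e) G \<cdot> x = zero_arr C (Dom C x) (Cod C (retr2 C (Dom C e) G))"
      using x y xy by simp
    then obtain h where h: "h \<in> Arr C" "Dom C h = Dom C x" "Cod C h = Dom C ?k" "?k \<cdot> h = x"
      by (rule kernel_factor[OF T_kernel[of "Dom C e" G], rotated 4]) (use x in auto)
    have "?l \<cdot> (T_map C G e \<cdot> h) = (?e \<cdot> ?k) \<cdot> h"
      by (rule comp_reduce[OF T_incl_T_map]) (use h in simp_all)
    then have "T_map C G e \<cdot> h = y"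
      by - (rule T_eqI[of _ _ G "Cod C e"]; use h x y xy in simp)
    then show "\<exists>!h. h \<in> hom C X (Dom C ?k) \<and> ?k \<cdot> h = x \<and> T_map C G e \<cdot> h = y"
    proof (intro ex1I[of _ h])
      fix h' assume h': "h' \<in> hom C X (Dom C ?k) \<and> ?k \<cdot> h' = x \<and> T_map C G e \<cdot> h' = y"
      show "h' = h" by (rule T_eqI[of _ _ G "Dom C e"]) (use h h' in simp_all)
    qed (use h x in simp)
  qed simp_all
  moreover have "regular_epi C ?e" using e by (rule regular_epi_sum_map) simp
  ultimately show ?thesis by (rule regular_epi_pullback)
qed

section \<open>Extending arrows and algebra structures\<close>

text \<open>The comparison \<open>b\<close> restricts \<open>\<langle>k,s\<rangle>\<close> to kernels over \<open>B\<close>; every arrow killed by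
  \<open>\<langle>k,s\<rangle>\<close> therefore comes from one killed by \<open>b\<close>.\<close>

lemma point_extension:
  assumes pt: "is_point C B p s" and k: "is_kernel C p k"
    and a: "a \<in> Arr C" "Cod C a = Dom C k" "k \<cdot> a = copair C k s \<cdot> cr2_incl C (Dom C k) B"
    and f: "f \<in> Arr C" "Dom C f = Dom C k" and g: "g \<in> Arr C" "Dom C g = B" "Cod C g = Cod C f"
    and fa: "f \<cdot> a = copair C f g \<cdot> cr2_incl C (Dom C k) B"
  obtains h where "h \<in> Arr C" "Dom C h = Dom C p" "Cod C h = Cod C f" "h \<cdot> k = f" "h \<cdot> s = g"
proof -
  note [simp] = is_pointD[OF pt] is_kernelD(1-3)[OF k] f g
  let ?K = "Dom C k" and ?e = "copair C k s"
  let ?T = "T_incl C B ?K" and ?j = "j_incl C ?K B" and ?u = "T_unit C B ?K"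
  have pe: "p \<cdot> ?e = retr2 C ?K B" using is_kernelD(4)[OF k] by (simp add: comp_copair retr2_def)
  have "p \<cdot> (?e \<cdot> ?T) = retr2 C ?K B \<cdot> ?T" by (rule comp_reduce[OF pe]) simp_all
  then have "p \<cdot> (?e \<cdot> ?T) = zero_arr C (Dom C (?e \<cdot> ?T)) (Cod C p)" by simp
  \<comment> \<open>\<open>?e\<close> is compatible with the projections to \<open>B\<close>, so it
    maps T_B of the kernel into the kernel. On the cross-effect \<open>b\<close> is the given action
    \<open>a\<close>, on the unit it is the identity.\<close>
  then obtain b where b: "b \<in> Arr C" "Dom C b = T_obj C B ?K" "Cod C b = ?K" "k \<cdot> b = ?e \<cdot> ?T"
    by (rule kernel_factor[OF k, rotated 2]) auto
  have kb: "k \<cdot> (b \<cdot> x) = ?e \<cdot> (?T \<cdot> x)" if "x \<in> Arr C"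
    "Cod C x = T_obj C B ?K" for x
    using comp_reduce[OF b(4), of x] b(1-3) that by simp
  have "b \<cdot> ?j = a"
    by (rule monicD[OF kernel_monic[OF k]]) (use a b(1-3) kb[of ?j] in \<open>simp_all add: T_incl_j\<close>)
  moreover have "b \<cdot> ?u = Ide C ?K"
    by (rule monicD[OF kernel_monic[OF k]]) (use b(1-3) kb[of ?u] in \<open>simp_all add: T_incl_unit\<close>)
  \<comment> \<open>The hypothesis \<open>fa\<close> is this equation on the cross-effect only. On
    the unit both sides are \<open>f\<close>, so it extends to all of T_B.\<close>
  ultimately have fb: "copair C f g \<cdot> ?T = f \<cdot> b"
    by - (rule T_jointly_epic[of ?K B]; use b(1-3) fa in \<open>simp add: T_incl_j T_incl_unit\<close>)
  have e: "regular_epi C ?e" by (rule point_copair_regular_epi[OF pt k])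
  obtain n where n: "is_kernel C ?e n" using kernel_exists[of ?e] by auto
  have [simp]: "n \<in> Arr C" "Cod C n = sum_obj C ?K B" using is_kernelD[OF n] by simp_all
  have n0: "?e \<cdot> n = zero_arr C (Dom C n) (Dom C p)" using is_kernelD(4)[OF n] by simp
  \<comment> \<open>The kernel \<open>n\<close> of \<open>?e\<close> is killed by the retraction
    onto \<open>B\<close> and therefore factors through \<open>?T\<close>, where \<open>fb\<close>
    applies.\<close>
  have "retr2 C ?K B \<cdot> n = p \<cdot> (?e \<cdot> n)" by (rule comp_reduce[OF pe, symmetric]) simp_all
  then have "retr2 C ?K B \<cdot> n = zero_arr C (Dom C n) (Cod C (retr2 C ?K B))" using n0 by simp
  then obtain m where m: "m \<in> Arr C" "Dom C m = Dom C n" "Cod C m = T_obj C B ?K" "?T \<cdot> m = n"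
    by (rule kernel_factor[OF T_kernel[of ?K B], rotated 4]) auto
  have bm: "b \<cdot> m = zero_arr C (Dom C n) ?K"
    by (rule monicD[OF kernel_monic[OF k]]) (use b(1-3) m kb[of m] n0 in simp_all)
  have "copair C f g \<cdot> (?T \<cdot> m) = (f \<cdot> b) \<cdot> m"
    by (rule comp_reduce[OF fb]) (use m in simp_all)
  then have "copair C f g \<cdot> n = zero_arr C (Dom C n) (Cod C (copair C f g))"
    using b(1-3) m bm by simp
  then obtain h where h: "h \<in> Arr C"
    "Dom C h = Cod C ?e" "Cod C h = Cod C (copair C f g)" "h \<cdot> ?e = copair C f g"
    by (rule regular_epi_cokernel[OF e n, rotated 2]) auto
  have "h \<cdot> (?e \<cdot> inj1 C ?K B) = copair C f g \<cdot> inj1 C ?K B"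
    "h \<cdot> (?e \<cdot> inj2 C ?K B) = copair C f g \<cdot> inj2 C ?K B"
    by (rule comp_reduce[OF h(4)]; use h(1-3) in simp)+
  then show thesis using h(1-3) by (intro that[of h]) simp_all
qed

context
  fixes A G
  assumes A [simp]: "A \<in> Obj C" and G [simp]: "G \<in> Obj C"
begin

abbreviation (input) "K \<equiv> cr2 C A G"
abbreviation (input) "jA \<equiv> j_incl C A G"
abbreviation (input) "uA \<equiv> T_unit C G A"
abbreviation (input) "eA \<equiv> copair C jA uA"

lemma conj_T'_typing [simp]:
  "conj_T' C A G \<in> Arr C" "Dom C (conj_T' C A G) = cr2 C (T_obj C G A) G" "Cod C (conj_T' C A G) = K"
  using conj_T'_hom[OF A G] by simp_all

lemma conj_cr2_typing [simp]:
  "conj_cr2_1 C A G \<in> Arr C" "Dom C (conj_cr2_1 C A G) = cr2 C K A" "Cod C (conj_cr2_1 C A G) = K"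
  "conj_cr2_2 C A G \<in> Arr C" "Dom C (conj_cr2_2 C A G) = cr2 C K G" "Cod C (conj_cr2_2 C A G) = K"
  using conj_cr2_1_hom[OF A G] conj_cr2_2_hom[OF A G] by simp_all

text \<open>Here conjugation enters the associativity law: multiplication and conjugation by G are
  both restrictions of \<langle>k,i_G\<rangle>, the one to T(TA) and the other to (TA|G).\<close>

lemma T_mult_j: "T_mult C G A \<cdot> j_incl C (T_obj C G A) G = jA \<cdot> conj_T' C A G"
proof (rule T_eqI[of _ _ G A])
  have "T_incl C G A \<cdot> (T_mult C G A \<cdot> j_incl C (T_obj C G A) G)
      = (copair C (T_incl C G A) (inj2 C A G) \<cdot> T_incl C G (T_obj C G A)) \<cdot> j_incl C (T_obj C G A) G"
    by (rule comp_reduce[OF T_incl_T_mult]) simp_all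
  moreover have "T_incl C G A \<cdot> (jA \<cdot> conj_T' C A G) = cr2_incl C A G \<cdot> conj_T' C A G"
    by (rule comp_reduce[OF T_incl_j]) simp_all
  ultimately show "T_incl C G A \<cdot> (T_mult C G A \<cdot> j_incl C (T_obj C G A) G) = T_incl C G A \<cdot> (jA \<cdot> conj_T' C A G)"
    by (simp add: T_incl_j conj_T')
qed simp_all

lemma conj_T'_cr2_map:
  assumes [simp]: "a \<in> Arr C" and a: "Cod C a = T_obj C G A"
  shows "cr2_incl C A G \<cdot> (conj_T' C A G \<cdot> cr2_map C a (Ide C G))
    = copair C (T_incl C G A \<cdot> a) (inj2 C A G) \<cdot> cr2_incl C (Dom C a) G"
proof -
  have "cr2_incl C A G \<cdot> (conj_T' C A G \<cdot> cr2_map C a (Ide C G))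
      = (copair C (T_incl C G A) (inj2 C A G) \<cdot> cr2_incl C (T_obj C G A) G) \<cdot> cr2_map C a (Ide C G)"
    by (rule comp_reduce[OF conj_T'[OF A G]]) (simp_all add: a)
  then show ?thesis
    using copair_cr2_map[of "T_incl C G A" "inj2 C A G" a "Ide C G"] by (simp add: a)
qed

text \<open>Source of the left side of equation (2): the inclusion of TA into A + G restricts along
  j to that of (A|G).\<close>

lemma conj_T'_j: "conj_T' C A G \<cdot> cr2_map C jA (Ide C G) = conj_cr2_2 C A G"
  by (rule cr2_eqI[of _ _ A G]) (simp_all add: conj_T'_cr2_map T_incl_j conj_cr2_2)

text \<open>The reason why the piece (A|G) of the decomposition gives no condition: on it the
  copairing becomes \<langle>i_A,i_G\<rangle>, the identity of A + G.\<close>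

lemma conj_T'_unit: "conj_T' C A G \<cdot> cr2_map C uA (Ide C G) = Ide C K"
proof (rule cr2_eqI[of _ _ A G])
  have "copair C (inj1 C A G) (inj2 C A G) = Ide C (sum_obj C A G)"
    by (rule sum_eqI[of _ _ A G]) simp_all
  then show "cr2_incl C A G \<cdot> (conj_T' C A G \<cdot> cr2_map C uA (Ide C G)) = cr2_incl C A G \<cdot> Ide C K"
    by (simp add: conj_T'_cr2_map T_incl_unit)
qed simp_all

text \<open>Seen from the point TA -> A, conjugation by A inside A + G is the action of the base on
  the kernel through the section. This is what \<open>point_extension\<close> asks of its arrow
  \<open>a\<close>.\<close>

lemma j_conj_cr2_1: "jA \<cdot> conj_cr2_1 C A G = eA \<cdot> cr2_incl C K A"
proof (rule T_eqI[of _ _ G A])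
  have "T_incl C G A \<cdot> (jA \<cdot> conj_cr2_1 C A G) = cr2_incl C A G \<cdot> conj_cr2_1 C A G"
    by (rule comp_reduce[OF T_incl_j]) simp_all
  moreover have "T_incl C G A \<cdot> eA = copair C (cr2_incl C A G) (inj1 C A G)"
    by (simp add: comp_copair T_incl_j T_incl_unit)
  then have "T_incl C G A \<cdot> (eA \<cdot> cr2_incl C K A) = copair C (cr2_incl C A G) (inj1 C A G) \<cdot> cr2_incl C K A"
    by (rule comp_reduce) simp_all
  ultimately show "T_incl C G A \<cdot> (jA \<cdot> conj_cr2_1 C A G) = T_incl C G A \<cdot> (eA \<cdot> cr2_incl C K A)"
    by (simp add: conj_cr2_1)
qed simp_all

text \<open>Sufficiency is \<open>point_extension\<close> for the point TA -> A with components
  \<psi> and the identity; necessity follows by applying \<xi> to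
  \<open>j_conj_cr2_1\<close>.\<close>

lemma extension_iff:
  assumes \<psi>: "\<psi> \<in> Arr C" "Dom C \<psi> = K" "Cod C \<psi> = A"
  shows "(\<exists>\<xi> \<in> hom C (T_obj C G A) A. \<xi> \<cdot> jA = \<psi> \<and> \<xi> \<cdot> uA = Ide C A) \<longleftrightarrow>
    \<psi> \<cdot> conj_cr2_1 C A G = c2 C A \<cdot> cr2_map C \<psi> (Ide C A)"
proof -
  note [simp] = \<psi>
  have c2: "c2 C A \<cdot> cr2_map C \<psi> (Ide C A) = copair C \<psi> (Ide C A) \<cdot> cr2_incl C K A"
    using c2_cr2_map[of \<psi> "Ide C A" A] by simp
  show ?thesis
  proof
    assume "\<exists>\<xi> \<in> hom C (T_obj C G A) A. \<xi> \<cdot> jA = \<psi> \<and> \<xi> \<cdot> uA = Ide C A"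
    then obtain \<xi> where [simp]: "\<xi> \<in> Arr C" "Dom C \<xi> = T_obj C G A" "Cod C \<xi> = A"
      and \<xi>: "\<xi> \<cdot> jA = \<psi>" "\<xi> \<cdot> uA = Ide C A" by auto
    have "\<psi> \<cdot> conj_cr2_1 C A G = \<xi> \<cdot> (jA \<cdot> conj_cr2_1 C A G)"
      by (rule comp_reduce[OF \<xi>(1), symmetric]) simp_all
    also have "\<dots> = copair C \<psi> (Ide C A) \<cdot> cr2_incl C K A"
      unfolding j_conj_cr2_1 by (rule comp_reduce) (simp_all add: comp_copair \<xi>)
    finally show "\<psi> \<cdot> conj_cr2_1 C A G = c2 C A \<cdot> cr2_map C \<psi> (Ide C A)"
      using c2 by simp
  next
    assume eq: "\<psi> \<cdot> conj_cr2_1 C A G = c2 C A \<cdot> cr2_map C \<psi> (Ide C A)"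
    obtain \<xi> where "\<xi> \<in> Arr C"
      "Dom C \<xi> = Dom C (retr1 C A G \<cdot> T_incl C G A)" "Cod C \<xi> = Cod C \<psi>"
      "\<xi> \<cdot> jA = \<psi>" "\<xi> \<cdot> uA = Ide C A"
      by (rule point_extension[OF T_point[OF A G] j_kernel[OF A G], of "conj_cr2_1 C A G" \<psi> "Ide C A"])
        (use j_conj_cr2_1 eq c2 in simp_all)
    then show "\<exists>\<xi> \<in> hom C (T_obj C G A) A. \<xi> \<cdot> jA = \<psi> \<and> \<xi> \<cdot> uA = Ide C A"
      by (intro bexI[of _ \<xi>]) simp_all
  qed
qed

text \<open>With the unit law given, only associativity is at stake. Necessity restricts it along j
  and then along two of the pieces; sufficiency reassembles the pieces on T((A|G) + A) and cancels
  Te.\<close>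

lemma T_algebra_iff:
  assumes \<xi>: "\<xi> \<in> Arr C" "Dom C \<xi> = T_obj C G A" "Cod C \<xi> = A"
    and unit: "\<xi> \<cdot> uA = Ide C A" and j: "\<xi> \<cdot> jA = \<psi>"
  shows "T_algebra C G A \<xi> \<longleftrightarrow>
    \<psi> \<cdot> conj_cr2_2 C A G = \<psi> \<cdot> cr2_map C \<psi> (Ide C G) \<and>
    \<psi> \<cdot> conj_T' C A G \<cdot> cr2_map C eA (Ide C G) \<cdot> cr3_incl C K A G
      = \<psi> \<cdot> cr2_map C (copair C \<psi> (Ide C A)) (Ide C G) \<cdot> cr3_incl C K A G"
proof -
  note [simp] = \<xi>
  have [simp]: "\<psi> \<in> Arr C" "Dom C \<psi> = K" "Cod C \<psi> = A" using j by auto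
  let ?c = "conj_T' C A G" and ?I = "Ide C G" and ?X = "sum_obj C K A"
  let ?q = "copair C \<psi> (Ide C A)"
  have \<xi>e: "\<xi> \<cdot> eA = ?q" by (simp add: comp_copair unit j)
  have i3: "cr3_incl C K A G \<in> Arr C" "Cod C (cr3_incl C K A G) = cr2 C ?X G"
    using is_kernelD[OF ker_is_kernel[of "pair C (cr2_map C (retr1 C K A) ?I) (cr2_map C (retr2 C K A) ?I)"]]
    by (simp_all add: cr3_incl_def)
  have mult_j: "(\<xi> \<cdot> T_mult C G A) \<cdot> j_incl C (T_obj C G A) G = \<psi> \<cdot> ?c"
    using T_mult_j comp_reduce[OF j, of ?c] by simp
  have map_j: "(\<xi> \<cdot> T_map C G \<xi>) \<cdot> j_incl C (T_obj C G A) G = \<psi> \<cdot> cr2_map C \<xi> ?I"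
    using T_map_j[of \<xi> G] comp_reduce[OF j, of "cr2_map C \<xi> ?I"] by simp
  have alg: "T_algebra C G A \<xi> \<longleftrightarrow> \<xi> \<cdot> T_mult C G A = \<xi> \<cdot> T_map C G \<xi>"
    by (simp add: T_algebra_def unit)
  \<comment> \<open>The restrictions of \<psi>(\<xi>|1) give the right side of (2), then \<psi>
    itself, then the arrow whose restriction is the right side of (3). In the last case the unit law
    turns \<xi> e into \<langle>\<psi>,1\<rangle>.\<close>
  have left: "(\<psi> \<cdot> cr2_map C \<xi> ?I) \<cdot> cr2_map C jA ?I = \<psi> \<cdot> cr2_map C \<psi> ?I"
    "(\<psi> \<cdot> cr2_map C \<xi> ?I) \<cdot> cr2_map C uA ?I = \<psi>"
    "(\<psi> \<cdot> cr2_map C \<xi> ?I) \<cdot> cr2_map C eA ?I = \<psi> \<cdot> cr2_map C ?q ?I"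
    by (simp_all add: cr2_map_comp j unit \<xi>e cr2_map_Ide)
  have right: "(\<psi> \<cdot> ?c) \<cdot> cr2_map C jA ?I = \<psi> \<cdot> conj_cr2_2 C A G"
    "(\<psi> \<cdot> ?c) \<cdot> cr2_map C uA ?I = \<psi>"
    by (simp_all add: conj_T'_j conj_T'_unit)
  show ?thesis
  proof
    assume "T_algebra C G A \<xi>"
    then have eq: "\<psi> \<cdot> ?c = \<psi> \<cdot> cr2_map C \<xi> ?I" using alg mult_j map_j by simp
    have "\<psi> \<cdot> conj_cr2_2 C A G = \<psi> \<cdot> cr2_map C \<psi> ?I"
      using left(1) right(1) unfolding eq by simp
    moreover have "(\<psi> \<cdot> ?c) \<cdot> cr2_map C eA ?I = \<psi> \<cdot> cr2_map C ?q ?I"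
      unfolding eq by (rule left(3))
    then have "((\<psi> \<cdot> ?c) \<cdot> cr2_map C eA ?I) \<cdot> cr3_incl C K A G = (\<psi> \<cdot> cr2_map C ?q ?I) \<cdot> cr3_incl C K A G"
      by (simp only:)
    then have "\<psi> \<cdot> ?c \<cdot> cr2_map C eA ?I \<cdot> cr3_incl C K A G = \<psi> \<cdot> cr2_map C ?q ?I \<cdot> cr3_incl C K A G"
      using i3 by simp
    ultimately show "\<psi> \<cdot> conj_cr2_2 C A G = \<psi> \<cdot> cr2_map C \<psi> ?I \<and>
      \<psi> \<cdot> ?c \<cdot> cr2_map C eA ?I \<cdot> cr3_incl C K A G = \<psi> \<cdot> cr2_map C ?q ?I \<cdot> cr3_incl C K A G" by blast
  next
    assume eqs: "\<psi> \<cdot> conj_cr2_2 C A G = \<psi> \<cdot> cr2_map C \<psi> ?I \<and>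
      \<psi> \<cdot> ?c \<cdot> cr2_map C eA ?I \<cdot> cr3_incl C K A G = \<psi> \<cdot> cr2_map C ?q ?I \<cdot> cr3_incl C K A G"
    have cross: "\<psi> \<cdot> ?c \<cdot> cr2_map C eA ?I = \<psi> \<cdot> cr2_map C ?q ?I"
    proof (rule cr3_jointly_epic[of K A G])
      show "(\<psi> \<cdot> ?c \<cdot> cr2_map C eA ?I) \<cdot> cr2_map C (inj1 C K A) ?I
          = (\<psi> \<cdot> cr2_map C ?q ?I) \<cdot> cr2_map C (inj1 C K A) ?I"
        using eqs by (simp add: cr2_map_comp conj_T'_j)
      show "(\<psi> \<cdot> ?c \<cdot> cr2_map C eA ?I) \<cdot> cr2_map C (inj2 C K A) ?I
          = (\<psi> \<cdot> cr2_map C ?q ?I) \<cdot> cr2_map C (inj2 C K A) ?I"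
        by (simp add: cr2_map_comp conj_T'_unit cr2_map_Ide)
    qed (use eqs i3 in simp_all)
    have "\<xi> \<cdot> T_mult C G A = \<xi> \<cdot> T_map C G \<xi>"
    \<comment> \<open>\<open>cross\<close> holds only after precomposition with (e|1). Passing to Te
      makes it usable, since j and the unit cover T((A|G) + A) and Te can be cancelled.\<close>
    proof (rule regular_epi_cancel[OF regular_epi_T_map[OF _ G]])
      show "regular_epi C eA" by (rule point_copair_regular_epi[OF T_point[OF A G] j_kernel[OF A G]])
      show "(\<xi> \<cdot> T_mult C G A) \<cdot> T_map C G eA = (\<xi> \<cdot> T_map C G \<xi>) \<cdot> T_map C G eA"
      proof (rule T_jointly_epic[of ?X G])
        have e_j: "T_map C G eA \<cdot> j_incl C ?X G = j_incl C (T_obj C G A) G \<cdot> cr2_map C eA ?I"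
          using T_map_j[of eA G] by simp
        have "((\<xi> \<cdot> T_mult C G A) \<cdot> T_map C G eA) \<cdot> j_incl C ?X G
            = ((\<xi> \<cdot> T_mult C G A) \<cdot> j_incl C (T_obj C G A) G) \<cdot> cr2_map C eA ?I"
          by (simp add: e_j)
        also have "\<dots> = ((\<xi> \<cdot> T_map C G \<xi>) \<cdot> j_incl C (T_obj C G A) G) \<cdot> cr2_map C eA ?I"
          unfolding mult_j map_j using cross left(3) by simp
        also have "\<dots> = ((\<xi> \<cdot> T_map C G \<xi>) \<cdot> T_map C G eA) \<cdot> j_incl C ?X G"
          by (simp add: e_j)
        finally show "((\<xi> \<cdot> T_mult C G A) \<cdot> T_map C G eA) \<cdot> j_incl C ?X G
          = ((\<xi> \<cdot> T_map C G \<xi>) \<cdot> T_map C G eA) \<cdot> j_incl C ?X G" .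
        have e_u: "T_map C G eA \<cdot> T_unit C G ?X = T_unit C G (T_obj C G A) \<cdot> eA"
          using T_map_unit[of eA G] by simp
        have m_u: "T_mult C G A \<cdot> (T_unit C G (T_obj C G A) \<cdot> eA) = Ide C (T_obj C G A) \<cdot> eA"
          by (rule comp_reduce[OF T_mult_unit]) simp_all
        have x_u: "T_map C G \<xi> \<cdot> (T_unit C G (T_obj C G A) \<cdot> eA) = (uA \<cdot> \<xi>) \<cdot> eA"
          using T_map_unit[of \<xi> G] by (intro comp_reduce) simp_all
        \<comment> \<open>On the unit, the multiplication side is \<xi> e by \<open>m_u\<close>; the
          other side carries an extra \<xi> \<eta>, which the unit law removes.\<close>
        have "\<xi> \<cdot> (uA \<cdot> (\<xi> \<cdot> eA)) = Ide C A \<cdot> (\<xi> \<cdot> eA)"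
          by (rule comp_reduce[OF unit]) simp_all
        then show "((\<xi> \<cdot> T_mult C G A) \<cdot> T_map C G eA) \<cdot> T_unit C G ?X
          = ((\<xi> \<cdot> T_map C G \<xi>) \<cdot> T_map C G eA) \<cdot> T_unit C G ?X"
          by (simp add: e_u m_u x_u)
      qed simp_all
    qed simp_all
    then show "T_algebra C G A \<xi>" using alg by simp
  qed
qed

end

end

theorem proposition31:
  fixes C :: "('o, 'm) cat" and A G :: 'o and \<psi> :: 'm
  assumes "homological C"
    and "finitely_cocomplete C"
    and "A \<in> Obj C" and "G \<in> Obj C"
    and "\<psi> \<in> hom C (cr2 C A G) A"
  shows "(\<exists>\<xi>. T_algebra C G A \<xi> \<and> \<xi> \<cdot>\<^bsub>C\<^esub> j_incl C A G = \<psi>) \<longleftrightarrow>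
     \<psi> \<cdot>\<^bsub>C\<^esub> conj_cr2_1 C A G = c2 C A \<cdot>\<^bsub>C\<^esub> cr2_map C \<psi> (Ide C A) \<and>
     \<psi> \<cdot>\<^bsub>C\<^esub> conj_cr2_2 C A G = \<psi> \<cdot>\<^bsub>C\<^esub> cr2_map C \<psi> (Ide C G) \<and>
     \<psi> \<cdot>\<^bsub>C\<^esub> conj_T' C A G \<cdot>\<^bsub>C\<^esub> cr2_map C (copair C (j_incl C A G) (T_unit C G A)) (Ide C G)
         \<cdot>\<^bsub>C\<^esub> cr3_incl C (cr2 C A G) A G
       = \<psi> \<cdot>\<^bsub>C\<^esub> cr2_map C (copair C \<psi> (Ide C A)) (Ide C G) \<cdot>\<^bsub>C\<^esub> cr3_incl C (cr2 C A G) A G"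
    (is "?alg \<longleftrightarrow> ?eq1 \<and> ?eq23")
proof -
  interpret homological_category C
    using assms(1,2) by unfold_locales (simp_all add: homological_def pointed_def)
  have \<psi>: "\<psi> \<in> Arr C" "Dom C \<psi> = cr2 C A G" "Cod C \<psi> = A" using assms(5) by simp_all
  note ext = extension_iff[OF assms(3,4) \<psi>]
  show ?thesis
  proof
    assume ?alg
    then obtain \<xi> where alg: "T_algebra C G A \<xi>"
      and j: "\<xi> \<cdot>\<^bsub>C\<^esub> j_incl C A G = \<psi>" by blast
    then have \<xi>: "\<xi> \<in> Arr C" "Dom C \<xi> = T_obj C G A" "Cod C \<xi> = A"
      and unit: "\<xi> \<cdot>\<^bsub>C\<^esub> T_unit C G A = Ide C A" by (simp_all add: T_algebra_def)
    have ?eq1 using ext \<xi> j unit by auto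
    moreover have ?eq23 using T_algebra_iff[OF assms(3,4) \<xi> unit j] alg by blast
    ultimately show "?eq1 \<and> ?eq23" ..
  next
    assume eqs: "?eq1 \<and> ?eq23"
    then obtain \<xi> where \<xi>: "\<xi> \<in> Arr C" "Dom C \<xi> = T_obj C G A" "Cod C \<xi> = A"
      and j: "\<xi> \<cdot>\<^bsub>C\<^esub> j_incl C A G = \<psi>"
        and unit: "\<xi> \<cdot>\<^bsub>C\<^esub> T_unit C G A = Ide C A"
      using ext by auto
    then show ?alg using T_algebra_iff[OF assms(3,4) \<xi> unit j] eqs by blast
  qed
qed

end
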